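(* Let $A\in\mathbb{C}^{r\times r}$ be such that $A+I$ is positive stable and $A+nI$ is invertible for all integers $n\ge 0$, and let $x$ be a positive real number. Then the following integral representations for the incomplete exponential matrix functions, in the variable $t$, hold true: $$e\big((x,t);A+I\big)=t^{-\frac{A}{2}}\int_0^x v^{\frac{A}{2}}e^{-v}I_A(2\sqrt{vt})\,dv,\qquad E\big((x,t);A+I\big)=t^{-\frac{A}{2}}\int_x^\infty v^{\frac{A}{2}}e^{-v}I_A(2\sqrt{vt})\,dv,$$ $$e\big((x,-t);A+I\big)=t^{-\frac{A}{2}}\int_0^x v^{\frac{A}{2}}e^{-v}J_A(2\sqrt{vt})\,dv,\qquad E\big((x,-t);A+I\big)=t^{-\frac{A}{2}}\int_x^\infty v^{\frac{A}{2}}e^{-v}J_A(2\sqrt{vt})\,dv.$$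
   Context: $\mathbb{C}^{r\times r}$ is the space of complex $r\times r$ matrices and $I$ (without subscript) is the identity matrix. A matrix $M$ is positive stable if every eigenvalue of $M$ has positive real part. Matrix powers of a scalar are $z^{M}=\exp(M\log z)$; the power $t^{-A/2}$ and the square root $\sqrt{t}$ are formed with the same determination of $\log t$. For positive stable $M$, $\Gamma(M)=\int_0^\infty e^{-s}s^{M-I}ds$, and $\Gamma^{-1}(M)$ is its matrix inverse. For $x>0$ and $M$ positive stable, $\gamma(M,x)=\int_0^x e^{-s}s^{M-I}ds$ and $\Gamma(M,x)=\int_x^\infty e^{-s}s^{M-I}ds$. For a positive stable matrix $M$ such that $M+kI$ is invertible for all integers $k\ge 0$, and $x>0$, the incomplete exponential matrix functions are $$e\big((x,t);M\big)=\sum_{m=0}^\infty \Gamma^{-1}(M+mI)\,\gamma(M+mI,x)\frac{t^m}{m!},\qquad E\big((x,t);M\big)=\sum_{m=0}^\infty \Gamma^{-1}(M+mI)\,\Gamma(M+mI,x)\frac{t^m}{m!}.$$ For $A$ such that $A+nI$ is invertible for all integers $n\ge 0$, the Bessel matrix function is $$J_A(z)=\sum_{m=0}^\infty \frac{(-1)^m\,\Gamma^{-1}(A+(m+1)I)}{m!}\Big(\frac z2\Big)^{A+2mI},$$ and the modified Bessel matrix function is $$I_A(z)=e^{-\frac{A i\pi}{2}}J_A(z e^{\frac{i\pi}{2}})\ \text{ for } -\pi<\arg z<\tfrac{\pi}{2},\qquad I_A(z)=e^{\frac{A i\pi}{2}}J_A(z e^{-\frac{i\pi}{2}})\ \text{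 for } -\tfrac{\pi}{2}<\arg z<\pi.$$ *)

theory Defs
  imports "HOL-Analysis.Analysis"
begin

text \<open>
  Matrices are of type \<^typ>\<open>complex^'n^'n\<close>, so \<^term>\<open>mat 1\<close> is the identity and
  \<^term>\<open>mat (of_nat k)\<close> is \<open>kI\<close>.
  The library multiplication \<open>*\<close> on this type is componentwise; matrix products are always
  written \<open>**\<close>.  For the same reason \<^const>\<open>exp\<close> and \<open>^\<close> are not usable on matrices.
\<close>

definition cscale :: "complex \<Rightarrow> complex^'n^'n \<Rightarrow> complex^'n^'n" (infixr "*\<^sub>C" 75) where
  "c *\<^sub>C M = (\<chi> i j. c * M $ i $ j)"

definition mat_exp :: "complex^'n^'n \<Rightarrow> complex^'n^'n" where
  "mat_exp M = (\<Sum>k. (1 / fact k) *\<^sub>R (((**) M ^^ k) (mat 1)))"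

definition is_eigenvalue :: "complex^'n^'n \<Rightarrow> complex \<Rightarrow> bool" where
  "is_eigenvalue M c \<longleftrightarrow> (\<exists>v. v \<noteq> 0 \<and> M *v v = c *s v)"

definition positive_stable :: "complex^'n^'n \<Rightarrow> bool" where
  "positive_stable M \<longleftrightarrow> (\<forall>c. is_eigenvalue M c \<longrightarrow> Re c > 0)"

text \<open>\<open>z\<close> to the power \<open>M\<close>, with the principal logarithm, for \<open>z \<noteq> 0\<close>.\<close>

definition mat_powr :: "complex \<Rightarrow> complex^'n^'n \<Rightarrow> complex^'n^'n" where
  "mat_powr z M = mat_exp (Ln z *\<^sub>C M)"

text \<open>
  The three integrals below are only meant for positive stable \<open>M\<close>, where they converge absolutely.
\<close>

definition mat_Gamma :: "complex^'n^'n \<Rightarrow> complex^'n^'n" where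
  "mat_Gamma M = (LBINT s=0..\<infinity>. exp (- s) *\<^sub>R mat_powr (of_real s) (M - mat 1))"

definition mat_lower_gamma :: "complex^'n^'n \<Rightarrow> real \<Rightarrow> complex^'n^'n" where
  "mat_lower_gamma M x = (LBINT s=0..ereal x. exp (- s) *\<^sub>R mat_powr (of_real s) (M - mat 1))"

definition mat_upper_gamma :: "complex^'n^'n \<Rightarrow> real \<Rightarrow> complex^'n^'n" where
  "mat_upper_gamma M x = (LBINT s=ereal x..\<infinity>. exp (- s) *\<^sub>R mat_powr (of_real s) (M - mat 1))"

definition incomplete_exp_e :: "real \<Rightarrow> complex \<Rightarrow> complex^'n^'n \<Rightarrow> complex^'n^'n" where
  "incomplete_exp_e x t M =
     (\<Sum>m. (t ^ m / fact m) *\<^sub>C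
        (matrix_inv (mat_Gamma (M + mat (of_nat m))) ** mat_lower_gamma (M + mat (of_nat m)) x))"

definition incomplete_exp_E :: "real \<Rightarrow> complex \<Rightarrow> complex^'n^'n \<Rightarrow> complex^'n^'n" where
  "incomplete_exp_E x t M =
     (\<Sum>m. (t ^ m / fact m) *\<^sub>C
        (matrix_inv (mat_Gamma (M + mat (of_nat m))) ** mat_upper_gamma (M + mat (of_nat m)) x))"

text \<open>
  Since \<^const>\<open>mat_Gamma\<close> is the integral, this is the Bessel matrix function when \<open>A + I\<close> is
  positive stable.
\<close>

definition bessel_J :: "complex^'n^'n \<Rightarrow> complex \<Rightarrow> complex^'n^'n" where
  "bessel_J A z =
     (\<Sum>m. ((- 1) ^ m / fact m) *\<^sub>C
        (matrix_inv (mat_Gamma (A + mat (of_nat (m + 1)))) ** mat_powr (z / 2) (A + mat (of_nat (2 * m)))))"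

text \<open>
  The first formula is the one for \<open>-\<pi> < arg z < \<pi>/2\<close>, the second the one for
  \<open>-\<pi>/2 < arg z < \<pi>\<close>; they agree on the overlap, where the first is used.
  In both, the rotated point again has its argument in \<open>(-\<pi>, \<pi>)\<close>, so the principal logarithm
  inside \<^const>\<open>bessel_J\<close> is the intended one.  On \<open>arg z = \<pi>\<close> there is no definition.
\<close>

definition bessel_I :: "complex^'n^'n \<Rightarrow> complex \<Rightarrow> complex^'n^'n" where
  "bessel_I A z =
     (if - pi < Arg z \<and> Arg z < pi / 2
      then mat_exp (- (\<i> * pi / 2) *\<^sub>C A) ** bessel_J A (z * exp (\<i> * pi / 2))
      else if - (pi / 2) < Arg z \<and> Arg z < pi
      then mat_exp ((\<i> * pi / 2) *\<^sub>C A) ** bessel_J A (z * exp (- (\<i> * pi / 2)))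
      else undefined)"

end

theory Submission
  imports Defs "HOL-Computational_Algebra.Fundamental_Theorem_Algebra" "HOL-Real_Asymp.Real_Asymp"
begin

text \<open>
  Since \<open>v\<^sup>A\<^sup>/\<^sup>2\<close>, \<open>t\<^sup>A\<^sup>/\<^sup>2\<close> and \<open>\<Gamma>\<^sup>-\<^sup>1(A + (m + 1)I)\<close> commute, \<open>t\<^sup>-\<^sup>A\<^sup>/\<^sup>2 v\<^sup>A\<^sup>/\<^sup>2 J\<^sub>A(2\<surd>(vt))\<close> is the
  series \<open>\<Sum> (-t)\<^sup>m / m! \<Gamma>\<^sup>-\<^sup>1(A + (m + 1)I) v\<^sup>A\<^sup>+\<^sup>m\<close>, and integrating it against \<open>e\<^sup>-\<^sup>v\<close> term by term gives
  the incomplete Gamma functions.  Three facts make this rigorous.  Positive stability of \<open>A + I\<close> gives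
  \<open>\<parallel>v\<^sup>A\<parallel> = O(v\<^sup>\<delta>\<^sup>-\<^sup>1)\<close> near \<open>0\<close> for some \<open>\<delta> > 0\<close>: factor a polynomial that annihilates \<open>A + I\<close> and integrate
  one linear factor at a time.  The matrices \<open>\<Gamma>(A + (m + 1)I)\<close> are invertible, as they act on eigenvectors
  as nonzero values of the scalar Gamma function.  Finally \<open>\<Gamma>(M + I) = M \<Gamma>(M)\<close> bounds the inverses well
  enough for dominated convergence.  The statements for \<open>I\<^sub>A\<close> are those for \<open>J\<^sub>A\<close> with \<open>log t\<close> shifted
  by \<open>\<plusminus>i\<pi>\<close>.
\<close>

section \<open>Matrices as a Banach algebra\<close>

text \<open>In finite dimension a bilinear map is automatically bounded; the passage of products
  through limits, series, derivatives and integrals rests on this.\<close>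

lemma bounded_bilinear_matrix_matrix_mult:
  "bounded_bilinear ((**) :: complex^'n^'m \<Rightarrow> complex^'k^'n \<Rightarrow> complex^'k^'m)"
proof -
  have "bilinear ((**) :: complex^'n^'m \<Rightarrow> complex^'k^'n \<Rightarrow> complex^'k^'m)"
    unfolding bilinear_def
    by (auto intro!: linearI simp: matrix_matrix_mult_def vec_eq_iff ring_distribs sum.distrib
        scaleR_sum_right)
  then show ?thesis
    by (simp add: bilinear_conv_bounded_bilinear)
qed

interpretation matmul: bounded_bilinear "(**) :: complex^'n^'n \<Rightarrow> complex^'n^'n \<Rightarrow> complex^'n^'n"
  by (rule bounded_bilinear_matrix_matrix_mult)

lemma bounded_bilinear_cscale: "bounded_bilinear ((*\<^sub>C) :: complex \<Rightarrow> complex^'n^'n \<Rightarrow> complex^'n^'n)"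
proof -
  have "bilinear ((*\<^sub>C) :: complex \<Rightarrow> complex^'n^'n \<Rightarrow> complex^'n^'n)"
    unfolding bilinear_def
    by (auto intro!: linearI simp: cscale_def vec_eq_iff ring_distribs)
  then show ?thesis
    by (simp add: bilinear_conv_bounded_bilinear)
qed

interpretation cscale: bounded_bilinear "(*\<^sub>C) :: complex \<Rightarrow> complex^'n^'n \<Rightarrow> complex^'n^'n"
  by (rule bounded_bilinear_cscale)

lemma cscale_matmul_left: "(c *\<^sub>C M) ** N = c *\<^sub>C (M ** N)"
  by (simp add: cscale_def matrix_matrix_mult_def vec_eq_iff sum_distrib_left mult_ac)

lemma cscale_matmul_right: "M ** (c *\<^sub>C N) = c *\<^sub>C (M ** N)"
  by (simp add: cscale_def matrix_matrix_mult_def vec_eq_iff sum_distrib_left mult_ac)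

lemma cscale_cscale [simp]: "c *\<^sub>C d *\<^sub>C M = (c * d) *\<^sub>C M"
  by (simp add: cscale_def vec_eq_iff mult_ac)

lemma cscale_1 [simp]: "1 *\<^sub>C M = M"
  by (simp add: cscale_def vec_eq_iff)

lemma cscale_of_real: "complex_of_real r *\<^sub>C M = r *\<^sub>R M"
  by (simp add: cscale_def vec_eq_iff scaleR_conv_of_real[where 'a = complex])

lemma cscale_mat: "c *\<^sub>C mat d = mat (c * d)"
  by (simp add: cscale_def vec_eq_iff mat_def)

lemma mat_matmul: "mat c ** M = c *\<^sub>C M"
  by (metis cscale_mat cscale_matmul_left matrix_mul_lid mult.right_neutral)

lemma matmul_mat: "M ** mat c = c *\<^sub>C M"
  by (metis cscale_mat cscale_matmul_right matrix_mul_rid mult.right_neutral)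

lemma mat_0 [simp]: "mat 0 = 0"
  by (simp add: mat_def vec_eq_iff)

lemma mat_add: "mat (a + b) = mat a + (mat b :: 'a::monoid_add^'n^'n)"
  by (simp add: mat_def vec_eq_iff)

lemma mat_diff: "mat (a - b) = mat a - (mat b :: 'a::group_add^'n^'n)"
  by (simp add: mat_def vec_eq_iff)

lemma norm_cscale: "norm (c *\<^sub>C M) = norm c * norm M"
  by (simp add: cscale_def norm_vec_def norm_mult L2_set_right_distrib)

text \<open>
  The type \<open>complex^'n^'n\<close> carries the componentwise product and a norm with \<open>norm (mat 1) \<noteq> 1\<close>,
  so it is copied to a type whose product is \<open>**\<close> and whose norm is the operator norm of
  left multiplication; the library theory of \<^const>\<open>exp\<close> then applies.
\<close>

typedef (overloaded) 'n cmat = "UNIV :: (complex^'n^'n) set"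
  by simp

declare Abs_cmat_inverse [OF UNIV_I, simp] Rep_cmat_inverse [simp]

lemma cmat_eq_iff: "X = Y \<longleftrightarrow> Rep_cmat X = Rep_cmat Y"
  by (simp add: Rep_cmat_inject)

instantiation cmat :: (finite) real_vector
begin
definition "(0 :: 'a cmat) = Abs_cmat 0"
definition "X + (Y :: 'a cmat) = Abs_cmat (Rep_cmat X + Rep_cmat Y)"
definition "- (X :: 'a cmat) = Abs_cmat (- Rep_cmat X)"
definition "X - (Y :: 'a cmat) = Abs_cmat (Rep_cmat X - Rep_cmat Y)"
definition "r *\<^sub>R (X :: 'a cmat) = Abs_cmat (r *\<^sub>R Rep_cmat X)"
instance
  by standard (simp_all add: cmat_eq_iff zero_cmat_def plus_cmat_def uminus_cmat_def
      minus_cmat_def scaleR_cmat_def scaleR_add_left scaleR_add_right)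
end

instantiation cmat :: (finite) real_algebra_1
begin
definition "(1 :: 'a cmat) = Abs_cmat (mat 1)"
definition "X * (Y :: 'a cmat) = Abs_cmat (Rep_cmat X ** Rep_cmat Y)"
instance
proof
  have "(mat 1 :: complex^'a^'a) $ i $ i \<noteq> 0" for i
    by (simp add: mat_def)
  then have "(mat 1 :: complex^'a^'a) \<noteq> 0"
    by (metis zero_index)
  then show "(0 :: 'a cmat) \<noteq> 1"
    by (simp add: cmat_eq_iff zero_cmat_def one_cmat_def)
qed (simp_all add: cmat_eq_iff plus_cmat_def scaleR_cmat_def one_cmat_def times_cmat_def
    matrix_mul_assoc matmul.add_left matmul.add_right matmul.scaleR_left matmul.scaleR_right)
end

lemma Rep_cmat_simps [simp]:
  "Rep_cmat 0 = 0" "Rep_cmat (X + Y) = Rep_cmat X + Rep_cmat Y"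
  "Rep_cmat (- X) = - Rep_cmat X" "Rep_cmat (X - Y) = Rep_cmat X - Rep_cmat Y"
  "Rep_cmat (r *\<^sub>R X) = r *\<^sub>R Rep_cmat X" "Rep_cmat 1 = mat 1"
  "Rep_cmat (X * Y) = Rep_cmat X ** Rep_cmat Y"
  by (simp_all add: zero_cmat_def plus_cmat_def uminus_cmat_def minus_cmat_def scaleR_cmat_def
      one_cmat_def times_cmat_def)

instantiation cmat :: (finite) real_normed_algebra_1
begin
definition "norm (X :: 'a cmat) = onorm (\<lambda>Y :: complex^'a^'a. Rep_cmat X ** Y)"
definition "sgn (X :: 'a cmat) = inverse (norm X) *\<^sub>R X"
definition "dist X (Y :: 'a cmat) = norm (X - Y)"
definition "uniformity = (INF e\<in>{0<..}. principal {(X, Y :: 'a cmat). dist X Y < e})"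
definition "open U \<longleftrightarrow> (\<forall>x\<in>U. \<forall>\<^sub>F (x', y) in uniformity. x' = x \<longrightarrow> (y :: 'a cmat) \<in> U)"
instance
proof
  fix X Y :: "'a cmat" and r :: real
  have bl: "bounded_linear (\<lambda>Y :: complex^'a^'a. Rep_cmat X ** Y)" for X :: "'a cmat"
    by (rule matmul.bounded_linear_right)
  show "norm X = 0 \<longleftrightarrow> X = 0"
  proof
    assume "norm X = 0"
    then have "Rep_cmat X ** mat 1 = 0"
      using onorm_eq_0[OF bl] by (metis norm_cmat_def)
    then show "X = 0"
      by (simp add: cmat_eq_iff)
  qed (simp add: norm_cmat_def onorm_zero)
  show "norm (X + Y) \<le> norm X + norm Y"
    using onorm_triangle[OF bl bl, of X Y] by (simp add: norm_cmat_def matmul.add_left)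
  show "norm (r *\<^sub>R X) = \<bar>r\<bar> * norm X"
    using onorm_scaleR[OF bl, of r X] by (simp add: norm_cmat_def matmul.scaleR_left)
  show "norm (X * Y) \<le> norm X * norm Y"
    using onorm_compose[OF bl bl, of X Y] by (simp add: norm_cmat_def o_def matrix_mul_assoc)
  have "onorm (\<lambda>B::complex^'a^'a. B) = 1"
    by (rule onorm_id)
  then show "norm (1 :: 'a cmat) = 1"
    by (simp add: norm_cmat_def)
qed (simp_all add: sgn_cmat_def dist_cmat_def uniformity_cmat_def open_cmat_def)
end

text \<open>Left multiplication by a matrix sends the identity to that matrix, so the operator norm
  controls the norm of \<open>complex^'n^'n\<close> up to the constant
  \<open>norm (mat 1)\<close>.\<close>

lemma norm_Rep_cmat_le: "norm (Rep_cmat X) \<le> norm X * norm (mat 1 :: complex^'n^'n)"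
  for X :: "'n::finite cmat"
  using onorm[OF matmul.bounded_linear_right, of "Rep_cmat X" "mat 1"] by (simp add: norm_cmat_def)

lemma bounded_linear_Rep_cmat: "bounded_linear (Rep_cmat :: 'n::finite cmat \<Rightarrow> complex^'n^'n)"
  by (rule bounded_linear_intro[where K = "norm (mat 1 :: complex^'n^'n)"])
     (auto simp: norm_Rep_cmat_le)

text \<open>Together with \<open>norm_Rep_cmat_le\<close> this makes the two norms equivalent, so
  completeness and limits carry over between the two types.\<close>

lemma bounded_linear_Abs_cmat: "bounded_linear (Abs_cmat :: complex^'n^'n \<Rightarrow> 'n::finite cmat)"
proof -
  obtain K where K: "norm (X ** Y) \<le> norm X * norm Y * K" for X Y :: "complex^'n^'n"
    using matmul.bounded by blast
  show ?thesis
  proof (rule bounded_linear_intro[where K = K])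
    fix X :: "complex^'n^'n"
    have "norm (X ** Y) \<le> norm X * K * norm Y" for Y :: "complex^'n^'n"
      using K[of X Y] by (simp only: mult_ac)
    then have "onorm (\<lambda>Y :: complex^'n^'n. X ** Y) \<le> norm X * K"
      by (rule onorm_le)
    then show "norm (Abs_cmat X) \<le> norm X * K"
      by (simp add: norm_cmat_def)
  qed (simp_all add: cmat_eq_iff)
qed

instance cmat :: (finite) banach
proof
  fix X :: "nat \<Rightarrow> 'a cmat"
  assume "Cauchy X"
  then have "Cauchy (\<lambda>n. Rep_cmat (X n))"
    by (rule bounded_linear.Cauchy[OF bounded_linear_Rep_cmat])
  then obtain L where "(\<lambda>n. Rep_cmat (X n)) \<longlonglongrightarrow> L"
    using Cauchy_convergent convergent_def by blast
  then have "(\<lambda>n. Abs_cmat (Rep_cmat (X n))) \<longlonglongrightarrow> Abs_cmat L"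
    by (rule bounded_linear.tendsto[OF bounded_linear_Abs_cmat])
  then show "convergent X"
    by (auto simp: convergent_def)
qed

section \<open>The matrix exponential\<close>

lemma Rep_cmat_power: "Rep_cmat (Abs_cmat M ^ k) = ((**) M ^^ k) (mat 1)"
  by (induction k) simp_all

lemma mat_exp_sums: "(\<lambda>k. (1 / fact k) *\<^sub>R ((**) M ^^ k) (mat 1)) sums Rep_cmat (exp (Abs_cmat M))"
proof -
  have "(\<lambda>k. Abs_cmat M ^ k /\<^sub>R fact k) sums exp (Abs_cmat M)"
    by (rule exp_converges)
  from bounded_linear.sums[OF bounded_linear_Rep_cmat this] show ?thesis
    by (simp add: Rep_cmat_power inverse_eq_divide)
qed

lemma mat_exp_eq_exp: "mat_exp M = Rep_cmat (exp (Abs_cmat M))"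
  unfolding mat_exp_def by (rule sums_unique[OF mat_exp_sums, symmetric])

lemma mat_exp_0 [simp]: "mat_exp 0 = mat 1"
  by (simp add: mat_exp_eq_exp flip: zero_cmat_def)

lemma mat_exp_add_commuting:
  assumes "M ** N = N ** M"
  shows "mat_exp (M + N) = mat_exp M ** mat_exp N"
proof -
  have "Abs_cmat M * Abs_cmat N = Abs_cmat N * Abs_cmat M" "Abs_cmat (M + N) = Abs_cmat M + Abs_cmat N"
    by (simp_all add: cmat_eq_iff assms)
  then show ?thesis
    by (simp add: mat_exp_eq_exp exp_add_commuting)
qed

lemma mat_exp_cscale_add: "mat_exp ((c + d) *\<^sub>C M) = mat_exp (c *\<^sub>C M) ** mat_exp (d *\<^sub>C M)"
  by (simp add: cscale.add_left mat_exp_add_commuting cscale_matmul_left cscale_matmul_right mult.commute)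

text \<open>Every column of \<open>B\<close> is zero or an eigenvector, so each power of
  \<open>N\<close> acts on \<open>B\<close> as the same power of \<open>d\<close>. Square matrices
  stand in for vectors so that one product suffices throughout.\<close>

lemma mat_exp_eigen:
  assumes "N ** B = d *\<^sub>C B"
  shows "mat_exp N ** B = exp d *\<^sub>C B"
proof -
  have pow: "((**) N ^^ k) (mat 1) ** B = d ^ k *\<^sub>C B" for k
  proof (induction k)
    case (Suc k)
    have "((**) N ^^ Suc k) (mat 1) ** B = N ** (((**) N ^^ k) (mat 1) ** B)"
      by (simp add: matrix_mul_assoc)
    then show ?case
      by (simp add: Suc cscale_matmul_right assms mult_ac)
  qed simp
  have "(\<lambda>k. (1 / fact k) *\<^sub>R (((**) N ^^ k) (mat 1) ** B)) sums (mat_exp N ** B)"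
    using bounded_linear.sums[OF matmul.bounded_linear_left[of B] mat_exp_sums[of N]]
    by (simp add: mat_exp_eq_exp matmul.scaleR_left)
  moreover have "(\<lambda>k. (d ^ k /\<^sub>R fact k) *\<^sub>C B) sums (exp d *\<^sub>C B)"
    by (rule bounded_linear.sums[OF cscale.bounded_linear_left exp_converges])
  ultimately show ?thesis
    using sums_unique2 by (simp add: pow cscale.scaleR_left inverse_eq_divide)
qed

lemma mat_exp_mat: "mat_exp (mat d) = exp d *\<^sub>C mat 1"
  using mat_exp_eigen[of "mat d" "mat 1" d] by (simp add: cscale_mat)

lemma mat_exp_commute:
  assumes "M ** B = B ** M"
  shows "mat_exp M ** B = B ** mat_exp M"
proof -
  have pow: "((**) M ^^ k) (mat 1) ** B = B ** ((**) M ^^ k) (mat 1)" for k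
    by (induction k) (simp_all add: matrix_mul_assoc[symmetric], simp add: matrix_mul_assoc assms)
  have "(\<lambda>k. (1 / fact k) *\<^sub>R (((**) M ^^ k) (mat 1) ** B)) sums (mat_exp M ** B)"
    using bounded_linear.sums[OF matmul.bounded_linear_left[of B] mat_exp_sums[of M]]
    by (simp add: mat_exp_eq_exp matmul.scaleR_left)
  moreover have "(\<lambda>k. (1 / fact k) *\<^sub>R (B ** ((**) M ^^ k) (mat 1))) sums (B ** mat_exp M)"
    using bounded_linear.sums[OF matmul.bounded_linear_right[of B] mat_exp_sums[of M]]
    by (simp add: mat_exp_eq_exp matmul.scaleR_right)
  ultimately show ?thesis
    using sums_unique2 by (simp add: pow)
qed

lemma mat_exp_scaleR_has_vector_derivative:
  "((\<lambda>r. mat_exp (r *\<^sub>R M)) has_vector_derivative mat_exp (r *\<^sub>R M) ** M) (at r within T)"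
proof -
  have eq: "Abs_cmat (r *\<^sub>R M) = r *\<^sub>R Abs_cmat M" for r
    by (simp add: cmat_eq_iff)
  from bounded_linear.has_vector_derivative[OF bounded_linear_Rep_cmat
      exp_scaleR_has_vector_derivative_right[of "Abs_cmat M" r T]]
  show ?thesis
    by (simp add: mat_exp_eq_exp eq)
qed

text \<open>Crude growth of the exponential for arbitrary \<open>M\<close>; it serves for powers of
  a base greater than 1.\<close>

lemma norm_mat_exp_scaleR_le:
  obtains C a where "C > 0" "a \<ge> 0" "\<And>r. r \<ge> 0 \<Longrightarrow> norm (mat_exp (r *\<^sub>R M)) \<le> C * exp (a * r)"
proof
  let ?C = "norm (mat 1 :: complex^'a^'a)" and ?a = "norm (Abs_cmat M)"
  show "?C > 0" using Rep_cmat_simps(1,6) by (metis zero_less_norm_iff cmat_eq_iff zero_neq_one)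
  show "?a \<ge> 0" by simp
  fix r :: real assume r: "r \<ge> 0"
  have eq: "Abs_cmat (r *\<^sub>R M) = r *\<^sub>R Abs_cmat M"
    by (simp add: cmat_eq_iff)
  have "norm (mat_exp (r *\<^sub>R M)) \<le> norm (exp (r *\<^sub>R Abs_cmat M)) * ?C"
    by (simp add: mat_exp_eq_exp eq norm_Rep_cmat_le)
  also have "\<dots> \<le> exp (norm (r *\<^sub>R Abs_cmat M)) * ?C"
    by (intro mult_right_mono norm_exp) simp
  finally show "norm (mat_exp (r *\<^sub>R M)) \<le> ?C * exp (?a * r)"
    using r by (simp add: mult_ac)
qed

section \<open>Polynomials in a matrix and the growth of the exponential\<close>

text \<open>Horner's scheme, with every product formed by \<open>**\<close>.\<close>

definition mat_poly :: "complex poly \<Rightarrow> complex^'n^'n \<Rightarrow> complex^'n^'n" where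
  "mat_poly p M = fold_coeffs (\<lambda>a X. mat a + M ** X) p 0"

lemma mat_poly_0 [simp]: "mat_poly 0 M = 0"
  by (simp add: mat_poly_def)

lemma mat_poly_pCons [simp]: "mat_poly (pCons a p) M = mat a + M ** mat_poly p M"
  by (cases "p = 0 \<and> a = 0") (auto simp: mat_poly_def matmul.zero_right)

lemma mat_poly_add: "mat_poly (p + q) M = mat_poly p M + mat_poly q M"
  by (induction p q rule: poly_induct2) (simp_all add: mat_add matmul.add_right)

lemma mat_poly_smult: "mat_poly (smult c p) M = c *\<^sub>C mat_poly p M"
  by (induction p) (simp_all add: cscale.zero_right cscale.add_right cscale_mat cscale_matmul_right)

lemma mat_poly_diff: "mat_poly (p - q) M = mat_poly p M - mat_poly q M"
  using mat_poly_add[of "p - q" q M] by simp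

lemma mat_poly_sum: "mat_poly (sum p I) M = (\<Sum>i\<in>I. mat_poly (p i) M)"
  by (induction I rule: infinite_finite_induct) (simp_all add: mat_poly_add)

lemma mat_poly_commute: "M ** mat_poly p M = mat_poly p M ** M"
  by (induction p) (simp add: matmul.zero_right matmul.zero_left,
      simp add: matmul.add_right matmul.add_left mat_matmul matmul_mat, metis matrix_mul_assoc)

text \<open>The linear factor ends up on the right, where a matrix \<open>B\<close> multiplied by
  the polynomial can absorb it before an induction on the degree continues.\<close>

lemma mat_poly_linear_mult: "mat_poly ([:- c, 1:] * q) M = mat_poly q M ** (M - mat c)"
  by (simp add: mat_poly_diff mat_poly_smult mat_poly_commute matmul.diff_right matmul_mat)

text \<open>The powers of \<open>M\<close> lie in a space of finite real dimension \<open>N\<close>,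
  so \<open>N + 1\<close> of them satisfy a nontrivial linear relation.\<close>

lemma ex_annihilating_poly:
  obtains p where "p \<noteq> 0" "mat_poly p M = 0"
proof -
  define P where "P k = mat_poly (monom 1 k) M" for k
  define N where "N = DIM(complex^'a^'a)"
  show thesis
  \<comment> \<open>Coinciding powers collapse in the image set, where counting its elements would
    miss them; the difference of their monomials then annihilates \<open>M\<close> directly.\<close>
  proof (cases "inj_on P {..N}")
    case False
    then obtain i j where "i \<noteq> j" "P i = P j"
      by (auto simp: inj_on_def)
    then show thesis
      using that[of "monom 1 i - monom 1 j"] by (simp add: mat_poly_diff P_def monom_eq_iff')
  next
    case True
    then have "card (P ` {..N}) > N"
      by (simp add: card_image)
    then have "dependent (P ` {..N})"
      unfolding N_def by (intro dependent_biggerset) auto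
    then obtain u k where u: "(\<Sum>B\<in>P ` {..N}. u B *\<^sub>R B) = 0" and k: "k \<le> N" "u (P k) \<noteq> 0"
      by (auto simp: dependent_finite)
    define p where "p = (\<Sum>k\<le>N. monom (complex_of_real (u (P k))) k)"
    have "coeff p k = of_real (u (P k))"
      using k by (simp add: p_def coeff_sum)
    then have "p \<noteq> 0"
      using k by auto
    moreover have "mat_poly (monom (complex_of_real r) k) M = r *\<^sub>R P k" for r k
      using mat_poly_smult[of "of_real r" "monom 1 k" M] by (simp add: P_def smult_monom cscale_of_real)
    then have "mat_poly p M = (\<Sum>k\<le>N. u (P k) *\<^sub>R P k)"
      by (simp add: p_def mat_poly_sum)
    then have "mat_poly p M = 0"
      using u True by (simp add: sum.reindex)
    ultimately show thesis
      by (rule that)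
  qed
qed

text \<open>A nonzero \<open>B\<close> has a nonzero column, and that column is an
  eigenvector.\<close>

lemma is_eigenvalueI:
  fixes M B :: "complex^'n^'n"
  assumes "M ** B = c *\<^sub>C B" "B \<noteq> 0"
  shows "is_eigenvalue M c"
proof -
  from \<open>B \<noteq> 0\<close> obtain i j where ij: "B $ i $ j \<noteq> 0"
    by (auto simp: vec_eq_iff)
  define v where "v = (\<chi> k. B $ k $ j)"
  have "(M ** B) $ k $ j = c * B $ k $ j" for k
    by (simp add: assms cscale_def)
  then have "M *v v = c *s v"
    by (simp add: vec_eq_iff v_def matrix_vector_mult_def matrix_matrix_mult_def)
  moreover have "v \<noteq> 0"
    using ij by (auto simp: vec_eq_iff v_def)
  ultimately show ?thesis
    unfolding is_eigenvalue_def by blast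
qed

text \<open>The fundamental theorem of algebra supplies the root; the strict drop of the degree
  drives the inductions below.\<close>

lemma complex_poly_root_factor:
  fixes p :: "complex poly"
  assumes "degree p > 0"
  obtains c q where "p = [:- c, 1:] * q" "degree q < degree p" "q \<noteq> 0"
proof -
  obtain c where "poly p c = 0"
    using assms fundamental_theorem_of_algebra[of p] by (auto simp: constant_degree)
  then obtain q where q: "p = [:- c, 1:] * q"
    unfolding poly_eq_0_iff_dvd by (rule dvdE)
  moreover from q assms have "q \<noteq> 0" by auto
  ultimately show thesis
    using that[of c q] by (simp add: degree_mult_eq del: mult_pCons_left)
qed

text \<open>A nonzero constant acts as an invertible scalar; this is the base case of both
  inductions on the degree.\<close>

lemma mat_poly_degree_0:
  fixes M B :: "complex^'n^'n"
  assumes "degree p = 0" "p \<noteq> 0" "mat_poly p M ** B = 0"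
  shows "B = 0"
proof -
  obtain a where a: "p = [:a:]"
    using assms by (metis degree_eq_zeroE)
  then have "a *\<^sub>C B = 0" and "a \<noteq> 0"
    using assms by (auto simp: mat_matmul matmul.zero_right)
  then have "inverse a *\<^sub>C a *\<^sub>C B = 0"
    by (simp only: cscale.zero_right)
  then show ?thesis
    using \<open>a \<noteq> 0\<close> by simp
qed

text \<open>Apply the linear factors of an annihilating polynomial to \<open>B\<close> one after
  another: just before the product first vanishes, it is an eigenmatrix. As \<open>P\<close>
  survives every factor, the eigenmatrix can be found inside any invariant class, such as a
  kernel.\<close>

lemma ex_eigenmatrix:
  fixes M B :: "complex^'n^'n"
  assumes "P B" "B \<noteq> 0" and step: "\<And>B c. P B \<Longrightarrow> P ((M - mat c) ** B)"
  obtains B' c where "P B'" "B' \<noteq> 0" "M ** B' = c *\<^sub>C B'"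
proof -
  have "\<exists>B' c. P B' \<and> B' \<noteq> 0 \<and> M ** B' = c *\<^sub>C B'"
    if "p \<noteq> 0" "mat_poly p M ** B = 0" "P B" "B \<noteq> 0" for p B
    using that
  proof (induction "degree p" arbitrary: p B rule: less_induct)
    case less
    show ?case
    proof (cases "degree p = 0")
      case True
      then show ?thesis
        using less.prems mat_poly_degree_0 by blast
    next
      case False
      then obtain c q where q: "p = [:- c, 1:] * q" "degree q < degree p" "q \<noteq> 0"
        using complex_poly_root_factor by blast
      let ?B = "(M - mat c) ** B"
      have "mat_poly q M ** ?B = 0"
        using less.prems(2) by (simp add: q(1) mat_poly_linear_mult matrix_mul_assoc del: mult_pCons_left)
      show ?thesis
      proof (cases "?B = 0")
        case True
        then have "M ** B = c *\<^sub>C B"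
          by (simp add: matmul.diff_left mat_matmul)
        then show ?thesis
          using less.prems by blast
      next
        case False
        then show ?thesis
          using less.hyps[OF q(2,3) \<open>mat_poly q M ** ?B = 0\<close>] step less.prems(3) by blast
      qed
    qed
  qed
  moreover obtain p where "p \<noteq> 0" "mat_poly p M = 0"
    by (rule ex_annihilating_poly)
  ultimately show thesis
    using assms(1,2) that by (metis matmul.zero_left)
qed

section \<open>Exponential decay for positive stable matrices\<close>

lemma mat_exp_shift: "mat_exp (r *\<^sub>R (mat c - M)) = exp (c * of_real r) *\<^sub>C mat_exp ((- r) *\<^sub>R M)"
proof -
  have "mat_exp (r *\<^sub>R (mat c - M)) = mat_exp (mat (c * of_real r) + (- r) *\<^sub>R M)"
    by (simp add: scaleR_right_diff_distrib cscale_of_real[symmetric] cscale_mat mult.commute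
        cscale.diff_right cscale.minus_left)
  also have "\<dots> = mat_exp (mat (c * of_real r)) ** mat_exp ((- r) *\<^sub>R M)"
    by (intro mat_exp_add_commuting) (simp add: mat_matmul matmul_mat)
  finally show ?thesis
    by (simp add: mat_exp_mat cscale_matmul_left)
qed

text \<open>Induction on the degree of p = (X - c) q. The matrix D = (M - c) B is annihilated by
  q(M), so its decay is known, and exp(r (c - M)) B has derivative -exp(r (c - M)) D; integrating
  this and multiplying by exp(-c r) gives the decay for B. If q(M) B is nonzero, it is an
  eigenmatrix for c, whence Re c > 0; if it is zero, the induction hypothesis applies to B
  itself.\<close>

lemma mat_exp_decay_annihilated:
  fixes M B :: "complex^'n^'n"
  assumes "positive_stable M" "p \<noteq> 0" "mat_poly p M ** B = 0"
  shows "\<exists>C \<delta>. C \<ge> 0 \<and> \<delta> > 0 \<and> (\<forall>r\<ge>0. norm (mat_exp ((- r) *\<^sub>R M) ** B) \<le> C * exp (- \<delta> * r))"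
  using assms(2,3)
proof (induction "degree p" arbitrary: p B rule: less_induct)
  case less
  have B_0: ?case if "B = 0"
    using that by (intro exI[of _ 0] exI[of _ 1]) (simp add: matmul.zero_right)
  show ?case
  proof (cases "degree p = 0")
    case True
    then show ?thesis
      using less.prems mat_poly_degree_0 B_0 by blast
  next
    case False
    then obtain c q where q: "p = [:- c, 1:] * q" "degree q < degree p" "q \<noteq> 0"
      using complex_poly_root_factor by blast
    define D where "D = (M - mat c) ** B"
    have "mat_poly q M ** D = 0"
      using less.prems(2) by (simp add: D_def q(1) mat_poly_linear_mult matrix_mul_assoc del: mult_pCons_left)
    from less.hyps[OF q(2,3) this] obtain C \<delta> where C: "C \<ge> 0" "\<delta> > 0"
      and bound: "\<And>r. r \<ge> 0 \<Longrightarrow> norm (mat_exp ((- r) *\<^sub>R M) ** D) \<le> C * exp (- \<delta> * r)"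
      by blast
    show ?thesis
    proof (cases "mat_poly q M ** B = 0")
      case True
      then show ?thesis
        using less.hyps[OF q(2,3)] by blast
    next
      case nz: False
      have "(M - mat c) ** (mat_poly q M ** B) = mat_poly p M ** B"
        by (simp add: q(1) mat_poly_linear_mult matrix_mul_assoc matmul.diff_left matmul.diff_right
            mat_poly_commute mat_matmul matmul_mat del: mult_pCons_left)
      then have "M ** (mat_poly q M ** B) = c *\<^sub>C (mat_poly q M ** B)"
        using less.prems(2) by (simp add: matmul.diff_left mat_matmul)
      from is_eigenvalueI[OF this nz] have c: "Re c > 0"
        using assms(1) by (simp add: positive_stable_def)
      \<comment> \<open>Halving the minimum keeps \<epsilon> strictly below \<open>Re c\<close>, so
        \<open>k\<close> is positive and may be divided by. In the resonant case
        \<open>\<delta> = Re c\<close> the rate \<delta> itself would cost an extra factor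
        \<open>r\<close>.\<close>
      define \<epsilon> where "\<epsilon> = min \<delta> (Re c) / 2"
      have \<epsilon>: "\<epsilon> > 0" "\<epsilon> \<le> \<delta>" "\<epsilon> < Re c"
        using c C by (auto simp: \<epsilon>_def)
      define k where "k = Re c - \<epsilon>"
      have k: "k > 0"
        using \<epsilon> by (simp add: k_def)
      define f where "f r = mat_exp (r *\<^sub>R (mat c - M)) ** B" for r
      have norm_exp: "norm (mat_exp (r *\<^sub>R (mat c - M)) ** X) = exp (Re c * r) * norm (mat_exp ((- r) *\<^sub>R M) ** X)"
        for r and X :: "complex^'n^'n"
        by (simp add: mat_exp_shift cscale_matmul_left norm_cscale)
      have f': "(f has_vector_derivative (mat_exp (r *\<^sub>R (mat c - M)) ** (- D))) (at r)" for r
        using bounded_linear.has_vector_derivative[OF matmul.bounded_linear_left[of B]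
            mat_exp_scaleR_has_vector_derivative[of "mat c - M" r UNIV]]
        by (simp add: f_def[abs_def] D_def matrix_mul_assoc[symmetric] matmul.diff_left)
      have f'_bound: "norm (mat_exp (r *\<^sub>R (mat c - M)) ** (- D)) \<le> C * exp (k * r)" if "r \<ge> 0" for r
      proof -
        have "norm (mat_exp (r *\<^sub>R (mat c - M)) ** (- D)) = exp (Re c * r) * norm (mat_exp ((- r) *\<^sub>R M) ** D)"
          by (simp add: matmul.minus_right norm_exp)
        also have "\<dots> \<le> exp (Re c * r) * (C * exp (- \<delta> * r))"
          by (intro mult_left_mono bound that) simp
        also have "\<dots> = C * exp ((Re c - \<delta>) * r)"
          by (simp add: algebra_simps flip: exp_add)
        also have "\<dots> \<le> C * exp (k * r)"
          using \<epsilon> that C by (intro mult_left_mono) (auto simp: k_def intro!: mult_right_mono)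
        finally show ?thesis .
      qed
      have f_bound: "norm (f r) \<le> norm B + C / k * exp (k * r)" if "r \<ge> 0" for r
      proof (cases "r = 0")
        case True
        then show ?thesis using C k by (simp add: f_def)
      next
        case False
        \<comment> \<open>Mean value inequality: the norm of the derivative of \<open>f\<close> is
          at most the derivative of \<open>C / k * exp (k * r)\<close>.\<close>
        have "norm (f r - f 0) \<le> C / k * exp (k * r) - C / k * exp (k * 0)"
        proof (rule differentiable_bound_general)
          show "0 < r" using False that by simp
          show "continuous_on {0..r} f"
            using f' by (meson continuous_at_imp_continuous_on has_vector_derivative_continuous)
          show "continuous_on {0..r} (\<lambda>r. C / k * exp (k * r))"
            by (intro continuous_intros)
          show "((\<lambda>r. C / k * exp (k * r)) has_vector_derivative C * exp (k * y)) (at y)" for y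
            unfolding has_real_derivative_iff_has_vector_derivative[symmetric]
            using k by (auto intro!: derivative_eq_intros)
        qed (use f' f'_bound in auto)
        moreover have "C / k * exp (k * 0) \<ge> 0"
          using C k by simp
        moreover have "f 0 = B"
          by (simp add: f_def)
        ultimately show ?thesis
          using norm_triangle_ineq2[of "f r" B] by simp
      qed
      have "norm (mat_exp ((- r) *\<^sub>R M) ** B) \<le> (norm B + C / k) * exp (- \<epsilon> * r)" if "r \<ge> 0" for r
      proof -
        have "norm (mat_exp ((- r) *\<^sub>R M) ** B) = exp (- (Re c * r)) * norm (f r)"
          by (simp add: f_def norm_exp exp_minus)
        also have "\<dots> \<le> exp (- (Re c * r)) * (norm B + C / k * exp (k * r))"
          by (intro mult_left_mono f_bound that) simp
        also have "\<dots> = norm B * exp (- (Re c * r)) + C / k * exp (- \<epsilon> * r)"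
          by (simp add: algebra_simps k_def flip: exp_add)
        also have "\<dots> \<le> norm B * exp (- \<epsilon> * r) + C / k * exp (- \<epsilon> * r)"
          using \<epsilon> that by (intro add_right_mono mult_left_mono) (auto intro!: mult_right_mono)
        finally show ?thesis
          by (simp add: ring_distribs)
      qed
      moreover have "norm B + C / k \<ge> 0"
        using C k by simp
      ultimately show ?thesis
        using \<epsilon>(1) by blast
    qed
  qed
qed

text \<open>The case where \<open>B\<close> is the identity, for which an annihilating polynomial of
  \<open>M\<close> itself is available.\<close>

lemma positive_stable_mat_exp_decay:
  assumes "positive_stable M"
  obtains C \<delta> where "C \<ge> 0" "\<delta> > 0" "\<And>r. r \<ge> 0 \<Longrightarrow> norm (mat_exp ((- r) *\<^sub>R M)) \<le> C * exp (- \<delta> * r)"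
proof -
  obtain p where "p \<noteq> 0" "mat_poly p M = 0"
    by (rule ex_annihilating_poly)
  then show thesis
    using mat_exp_decay_annihilated[OF assms, of p "mat 1"] that by auto
qed

section \<open>The Gamma matrix function\<close>

lemma mat_powr_of_real: "s > 0 \<Longrightarrow> mat_powr (of_real s) M = mat_exp (ln s *\<^sub>R M)"
  by (simp add: mat_powr_def Ln_of_real cscale_of_real)

lemma mat_powr_add_mat:
  assumes "s > 0"
  shows "mat_powr (of_real s) (M + mat (of_real b)) = (s powr b) *\<^sub>R mat_powr (of_real s) M"
proof -
  have "ln s *\<^sub>R (M + mat (of_real b)) = mat (of_real (b * ln s)) + ln s *\<^sub>R M"
    by (simp add: scaleR_right_distrib cscale_of_real[symmetric] cscale_mat cscale.add_right mult.commute)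
  also have "mat_exp \<dots> = mat_exp (mat (of_real (b * ln s))) ** mat_exp (ln s *\<^sub>R M)"
    by (rule mat_exp_add_commuting) (simp add: mat_matmul matmul_mat)
  finally have "mat_powr (of_real s) (M + mat (of_real b)) = exp (complex_of_real (b * ln s)) *\<^sub>C mat_powr (of_real s) M"
    using assms by (simp add: mat_powr_of_real mat_exp_mat cscale_matmul_left)
  then show ?thesis
    using assms by (simp only: exp_of_real cscale_of_real powr_def) simp
qed

text \<open>Stability of \<open>M\<close> bounds the power with exponent \<open>M\<close>, while the
  Gamma kernel has exponent \<open>M - mat 1\<close>; the factor \<open>1 / s\<close> links the
  two.\<close>

lemma mat_powr_diff_mat_1:
  assumes "s > 0"
  shows "mat_powr (of_real s) (M - mat 1) = (1 / s) *\<^sub>R mat_powr (of_real s) M"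
  using mat_powr_add_mat[OF assms, of M "-1"] assms
  by (simp add: powr_minus inverse_eq_divide mat_diff[of 0 1, simplified])

lemma mat_powr_add_nat_diff_mat_1:
  assumes "s > 0"
  shows "mat_powr (of_real s) (M + mat (of_nat m) - mat 1) = (s ^ m) *\<^sub>R mat_powr (of_real s) (M - mat 1)"
  using mat_powr_add_mat[OF assms, of "M - mat 1" "real m"] assms
  by (simp add: powr_realpow algebra_simps)

lemma mat_powr_commute: "M ** B = B ** M \<Longrightarrow> mat_powr z M ** B = B ** mat_powr z M"
  unfolding mat_powr_def by (rule mat_exp_commute) (simp add: cscale_matmul_left cscale_matmul_right)

lemma mat_powr_has_vector_derivative:
  assumes "s > 0"
  shows "((\<lambda>s. mat_powr (of_real s) M) has_vector_derivative M ** mat_powr (of_real s) (M - mat 1)) (at s)"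
proof -
  have "(ln has_vector_derivative 1 / s) (at s)"
    using assms by (auto intro!: derivative_eq_intros simp flip: has_real_derivative_iff_has_vector_derivative)
  from vector_diff_chain_at[OF this mat_exp_scaleR_has_vector_derivative]
  have "((\<lambda>s. mat_exp (ln s *\<^sub>R M)) has_vector_derivative (1 / s) *\<^sub>R (mat_exp (ln s *\<^sub>R M) ** M)) (at s)"
    by (simp add: o_def)
  moreover have "mat_exp (ln s *\<^sub>R M) ** M = M ** mat_exp (ln s *\<^sub>R M)"
    by (rule mat_exp_commute) (simp add: matmul.scaleR_left matmul.scaleR_right)
  ultimately have "((\<lambda>s. mat_exp (ln s *\<^sub>R M)) has_vector_derivative M ** mat_powr (of_real s) (M - mat 1)) (at s)"
    unfolding mat_powr_diff_mat_1[OF assms] using assms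
    by (simp add: mat_powr_of_real matmul.scaleR_right)
  \<comment> \<open>The formula with \<open>ln\<close> is available for positive reals only, so the
    derivative is transferred within the open half-line.\<close>
  then show ?thesis
    by (rule has_vector_derivative_transform_within_open[of _ _ _ "{0<..}"])
       (use assms in \<open>auto simp: mat_powr_of_real\<close>)
qed

lemma isCont_mat_powr: "s > 0 \<Longrightarrow> isCont (\<lambda>s. mat_powr (complex_of_real s) M) s"
  using mat_powr_has_vector_derivative has_vector_derivative_continuous by blast

text \<open>For s at most 1 the decay estimate at r = -ln s gives a positive power of s; for larger
  s the growth estimate gives another power. The sum of both covers the whole half-line and leads to
  two scalar Gamma integrals.\<close>

lemma positive_stable_mat_powr_bound:
  assumes "positive_stable M"
  obtains K \<delta> a where "K \<ge> 0" "\<delta> > 0" "\<delta> \<le> a"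
    "\<And>s. s > 0 \<Longrightarrow> norm (mat_powr (of_real s) M) \<le> K * (s powr \<delta> + s powr a)"
proof -
  obtain C \<delta> where C: "C \<ge> 0" "\<delta> > 0"
    "\<And>r. r \<ge> 0 \<Longrightarrow> norm (mat_exp ((- r) *\<^sub>R M)) \<le> C * exp (- \<delta> * r)"
    using positive_stable_mat_exp_decay[OF assms] by blast
  obtain D b where D: "D > 0" "b \<ge> 0" "\<And>r. r \<ge> 0 \<Longrightarrow> norm (mat_exp (r *\<^sub>R M)) \<le> D * exp (b * r)"
    using norm_mat_exp_scaleR_le by blast
  show thesis
  \<comment> \<open>The growth exponent \<open>b\<close> may be 0; raising it to
    \<open>b + \<delta>\<close> makes it at least \<delta>, hence positive.\<close>
  proof (rule that[of "C + D" \<delta> "b + \<delta>"])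
    fix s :: real assume s: "s > 0"
    show "norm (mat_powr (of_real s) M) \<le> (C + D) * (s powr \<delta> + s powr (b + \<delta>))"
    proof (cases "s \<le> 1")
      case True
      have "norm (mat_powr (of_real s) M) \<le> C * s powr \<delta>"
        using C(3)[of "- ln s"] s True by (simp add: mat_powr_of_real powr_def)
      also have "\<dots> \<le> (C + D) * (s powr \<delta> + s powr (b + \<delta>))"
        using C D by (intro mult_mono) auto
      finally show ?thesis .
    next
      case False
      have "norm (mat_powr (of_real s) M) \<le> D * s powr b"
        using D(3)[of "ln s"] s False by (simp add: mat_powr_of_real powr_def)
      also have "\<dots> \<le> D * s powr (b + \<delta>)"
        using C D False by (intro mult_left_mono powr_mono) auto
      also have "\<dots> \<le> (C + D) * (s powr \<delta> + s powr (b + \<delta>))"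
        using C D by (intro mult_mono) auto
      finally show ?thesis .
    qed
  qed (use C D in auto)
qed

text \<open>Adding \<open>mat (of_nat m)\<close> moves each eigenvalue to the right by
  \<open>m\<close>.\<close>

lemma positive_stable_add_nat:
  assumes "positive_stable M"
  shows "positive_stable (M + mat (of_nat m))"
  unfolding positive_stable_def
proof (intro allI impI)
  fix c assume "is_eigenvalue (M + mat (of_nat m)) c"
  then obtain v where v: "v \<noteq> 0" "(M + mat (of_nat m)) *v v = c *s v"
    by (auto simp: is_eigenvalue_def)
  have "mat (of_nat m) *v v = of_nat m *s v"
    by (simp add: vec_eq_iff matrix_vector_mult_def mat_def if_distrib[of "\<lambda>x. x * _"] cong: if_cong)
  then have "M *v v = (c - of_nat m) *s v"
    using v by (simp add: matrix_vector_mult_add_rdistrib vector_sub_rdistrib algebra_simps)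
  then have "Re (c - of_nat m) > 0"
    using assms v(1) unfolding positive_stable_def is_eigenvalue_def by blast
  then show "Re c > 0"
    by (simp add: add_pos_nonneg order_le_less_trans[of 0 "real m"])
qed

section \<open>Convergence of the Gamma integral and its functional equation\<close>

lemma has_bochner_integral_Gamma_real:
  fixes a :: real
  assumes "a > 0"
  shows "has_bochner_integral lborel (\<lambda>s. indicator {0<..} s *\<^sub>R (exp (- s) * s powr (a - 1))) (Gamma a)"
proof -
  have "has_bochner_integral lborel (\<lambda>s. indicator {0..} s * s powr (a - 1) / exp s) (Gamma a)"
    by (rule has_bochner_integral_nn_integral)
       (use assms in \<open>auto simp: Gamma_conv_nn_integral_real Gamma_real_pos less_imp_le\<close>)
  \<comment> \<open>Since \<open>0 powr b\<close> is 0, the integrand vanishes at the endpoint, and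
    the closed and open half-lines give the same function.\<close>
  also have "(\<lambda>s. indicator {0..} s * s powr (a - 1) / exp s)
      = (\<lambda>s. indicator {0<..} s *\<^sub>R (exp (- s) * s powr (a - 1)))"
    by (auto simp: fun_eq_iff indicator_def exp_minus field_simps)
  finally show ?thesis .
qed

lemma set_integral_bounded_linear:
  fixes f :: "real \<Rightarrow> 'a::{banach, second_countable_topology}"
    and T :: "'a \<Rightarrow> 'b::{banach, second_countable_topology}"
  assumes "bounded_linear T" "set_integrable M S f"
  shows "set_integrable M S (\<lambda>x. T (f x))" "(LINT x:S|M. T (f x)) = T (LINT x:S|M. f x)"
  using integrable_bounded_linear[OF assms(1)] integral_bounded_linear[OF assms(1)] assms
  by (simp_all add: set_integrable_def set_lebesgue_integral_def bounded_linear.linear linear_scale[symmetric])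

lemma set_borel_measurable_mat_powr:
  assumes "S \<in> sets borel" "S \<subseteq> {0<..}"
  shows "set_borel_measurable lborel S (\<lambda>s. exp (- s) *\<^sub>R mat_powr (of_real s) M)"
proof -
  have "isCont (\<lambda>s. exp (- s) *\<^sub>R mat_powr (of_real s) M) s" if "s \<in> S" for s
    using that assms(2) by (intro continuous_intros isCont_mat_powr) auto
  then have "continuous_on S (\<lambda>s. exp (- s) *\<^sub>R mat_powr (of_real s) M)"
    by (simp add: continuous_at_imp_continuous_on)
  then show ?thesis
    using borel_measurable_continuous_on_indicator[OF assms(1),
        of "\<lambda>s. exp (- s) *\<^sub>R mat_powr (of_real s) M"]
    by (simp add: set_borel_measurable_def)
qed

text \<open>The kernel is dominated by two scalar Gamma integrands with positive parameters. A
  general \<open>S\<close> covers the complete and both incomplete Gamma integrals.\<close>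

lemma set_integrable_Gamma_kernel:
  assumes "positive_stable M" and S: "S \<in> sets borel" "S \<subseteq> {0<..}"
  shows "set_integrable lborel S (\<lambda>s. exp (- s) *\<^sub>R mat_powr (of_real s) (M - mat 1))"
proof -
  obtain K \<delta> a where K: "K \<ge> 0" "\<delta> > 0" "\<delta> \<le> a"
    "\<And>s. s > 0 \<Longrightarrow> norm (mat_powr (of_real s) M) \<le> K * (s powr \<delta> + s powr a)"
    using positive_stable_mat_powr_bound[OF assms(1)] by blast
  define g where "g s = K * (exp (- s) * s powr (\<delta> - 1) + exp (- s) * s powr (a - 1))" for s
  have "set_integrable lborel {0<..} (\<lambda>s. exp (- s) * s powr (b - 1))" if "b > 0" for b :: real
    unfolding set_integrable_def using has_bochner_integral_Gamma_real[OF that]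
    by (auto simp: has_bochner_integral_iff)
  then have "set_integrable lborel {0<..} g"
    unfolding g_def[abs_def] using K by (intro set_integrable_mult_right set_integral_add) auto
  then have "set_integrable lborel S g"
    by (rule set_integrable_subset) (use S in auto)
  then show ?thesis
  proof (rule set_integrable_bound)
    show "set_borel_measurable lborel S (\<lambda>s. exp (- s) *\<^sub>R mat_powr (of_real s) (M - mat 1))"
      by (rule set_borel_measurable_mat_powr[OF S])
    have "norm (exp (- s) *\<^sub>R mat_powr (of_real s) (M - mat 1)) \<le> g s" if "s > 0" for s
    proof -
      have "norm (exp (- s) *\<^sub>R mat_powr (of_real s) (M - mat 1)) = exp (- s) / s * norm (mat_powr (of_real s) M)"
        using that by (simp add: mat_powr_diff_mat_1)
      also have "\<dots> \<le> exp (- s) / s * (K * (s powr \<delta> + s powr a))"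
        using that by (intro mult_left_mono K) auto
      also have "\<dots> = g s"
        using that by (simp add: g_def powr_diff field_simps)
      finally show ?thesis .
    qed
    then show "AE s in lborel. s \<in> S \<longrightarrow>
        norm (exp (- s) *\<^sub>R mat_powr (of_real s) (M - mat 1)) \<le> norm (g s)"
      using S(2) by (intro always_eventually) (force intro: order_trans[OF _ abs_ge_self])
  qed
qed

lemma mat_Gamma_eq: "mat_Gamma M = (LINT s:{0<..}|lborel. exp (- s) *\<^sub>R mat_powr (of_real s) (M - mat 1))"
  unfolding mat_Gamma_def interval_integral_to_infinity_eq
  by (simp add: interval_lebesgue_integral_def einterval_def greaterThan_def zero_ereal_def[symmetric])

text \<open>Integration by parts, in the form of the fundamental theorem of calculus for
  \<open>F\<close>, the power with exponent \<open>M\<close> times \<open>exp (- s)\<close>.\<close>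

lemma mat_Gamma_plus_1:
  assumes "positive_stable M"
  shows "mat_Gamma (M + mat 1) = M ** mat_Gamma M"
proof -
  obtain K \<delta> a where K: "K \<ge> 0" "\<delta> > 0" "\<delta> \<le> a"
    "\<And>s. s > 0 \<Longrightarrow> norm (mat_powr (of_real s) M) \<le> K * (s powr \<delta> + s powr a)"
    using positive_stable_mat_powr_bound[OF assms] by blast
  define F where "F s = exp (- s) *\<^sub>R mat_powr (of_real s) M" for s
  define g1 where "g1 s = exp (- s) *\<^sub>R mat_powr (of_real s) (M - mat 1)" for s
  \<comment> \<open>The exponent \<open>M + mat 1 - mat 1\<close> stays unsimplified so that
    \<open>g2\<close> is literally the Gamma kernel of \<open>M + mat 1\<close>.\<close>
  define g2 where "g2 s = exp (- s) *\<^sub>R mat_powr (of_real s) (M + mat 1 - mat 1)" for s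
  have 1: "set_integrable lborel {0<..} g1"
    unfolding g1_def[abs_def] by (rule set_integrable_Gamma_kernel) (use assms in auto)
  have 2: "set_integrable lborel {0<..} g2"
    unfolding g2_def[abs_def]
    by (rule set_integrable_Gamma_kernel) (use positive_stable_add_nat[OF assms, of 1] in auto)
  note M1 = set_integral_bounded_linear[OF matmul.bounded_linear_right[of M] 1]
  have ei: "einterval 0 \<infinity> = {0<..}"
    by (auto simp: einterval_def)
  have F_bound: "norm (F s) \<le> exp (- s) * (K * (s powr \<delta> + s powr a))" if "s > 0" for s
    using K(4)[OF that] by (simp add: F_def)
  \<comment> \<open>Both boundary values of \<open>F\<close> vanish: at 0 because \<delta> and
    \<open>a\<close> are positive, at infinity because of the exponential.\<close>
  have "(LBINT s=0..\<infinity>. M ** g1 s - g2 s) = 0 - 0"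
  proof (rule interval_integral_FTC_integrable)
    show "(F has_vector_derivative M ** g1 s - g2 s) (at s)" if "0 < ereal s" for s
    proof -
      have "s > 0" using that by simp
      have "((\<lambda>s. exp (- s)) has_real_derivative - exp (- s)) (at s)"
        by (auto intro!: derivative_eq_intros)
      then have "((\<lambda>s. exp (- s)) has_vector_derivative - exp (- s)) (at s)"
        by (simp add: has_real_derivative_iff_has_vector_derivative)
      from bounded_bilinear.has_vector_derivative[OF bounded_bilinear_scaleR this
          mat_powr_has_vector_derivative[OF \<open>s > 0\<close>, of M]]
      show ?thesis
        by (simp add: F_def[abs_def] g1_def g2_def matmul.scaleR_right)
    qed
    show "isCont (\<lambda>s. M ** g1 s - g2 s) s" if "0 < ereal s" for s
      unfolding g1_def g2_def using that
      by (intro continuous_intros matmul.continuous isCont_mat_powr) auto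
    show "set_integrable lborel (einterval 0 \<infinity>) (\<lambda>s. M ** g1 s - g2 s)"
      unfolding ei by (intro set_integral_diff M1 2)
    have lim: "((\<lambda>s. exp (- s) * s powr b) \<longlongrightarrow> 0) (at_right 0)" if "b > 0" for b :: real
      using that by real_asymp
    have "((\<lambda>s. K * (exp (- s) * s powr \<delta> + exp (- s) * s powr a)) \<longlongrightarrow> K * (0 + 0)) (at_right 0)"
      using K(2,3) by (intro tendsto_intros lim) auto
    then have "((\<lambda>s. exp (- s) * (K * (s powr \<delta> + s powr a))) \<longlongrightarrow> 0) (at_right 0)"
      by (simp add: algebra_simps)
    then have "(F \<longlongrightarrow> 0) (at_right 0)"
      by (rule Lim_null_comparison[rotated])
         (use F_bound in \<open>auto simp: eventually_at_right_field intro: exI[of _ 1]\<close>)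
    then show "((F \<circ> real_of_ereal) \<longlongrightarrow> 0) (at_right 0)"
      by (simp add: zero_ereal_def ereal_tendsto_simps)
    have lim: "((\<lambda>s. exp (- s) * s powr b) \<longlongrightarrow> 0) at_top" if "b > 0" for b :: real
      using that by real_asymp
    have "((\<lambda>s. K * (exp (- s) * s powr \<delta> + exp (- s) * s powr a)) \<longlongrightarrow> K * (0 + 0)) at_top"
      using K(2,3) by (intro tendsto_intros lim) auto
    then have "((\<lambda>s. exp (- s) * (K * (s powr \<delta> + s powr a))) \<longlongrightarrow> 0) at_top"
      by (simp add: algebra_simps)
    then have "(F \<longlongrightarrow> 0) at_top"
      by (rule Lim_null_comparison[rotated])
         (use F_bound in \<open>auto intro: eventually_mono[OF eventually_gt_at_top[of 0]]\<close>)
    then show "((F \<circ> real_of_ereal) \<longlongrightarrow> 0) (at_left \<infinity>)"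
      by (simp add: ereal_tendsto_simps)
  qed simp
  moreover have "(LBINT s=0..\<infinity>. M ** g1 s - g2 s) = (LINT s:{0<..}|lborel. M ** g1 s - g2 s)"
    by (simp add: interval_lebesgue_integral_def ei)
  moreover have "\<dots> = M ** mat_Gamma M - mat_Gamma (M + mat 1)"
    using M1 2 unfolding g1_def[abs_def] g2_def[abs_def] by (simp add: mat_Gamma_eq)
  ultimately show ?thesis
    by simp
qed

text \<open>The integrand commutes with \<open>B\<close> pointwise, and multiplication by
  \<open>B\<close> on either side passes through the integral.\<close>

lemma mat_Gamma_commute:
  assumes "positive_stable M" "M ** B = B ** M"
  shows "mat_Gamma M ** B = B ** mat_Gamma M"
proof -
  define g where "g s = exp (- s) *\<^sub>R mat_powr (of_real s) (M - mat 1)" for s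
  have int: "set_integrable lborel {0<..} g"
    unfolding g_def[abs_def] by (rule set_integrable_Gamma_kernel) (use assms in auto)
  have "g s ** B = B ** g s" for s
    using mat_powr_commute[of "M - mat 1" B "of_real s"] assms(2)
    by (simp add: g_def matmul.scaleR_left matmul.scaleR_right matmul.diff_left matmul.diff_right)
  then have "(LINT s:{0<..}|lborel. g s ** B) = (LINT s:{0<..}|lborel. B ** g s)"
    by simp
  then show ?thesis
    unfolding set_integral_bounded_linear(2)[OF matmul.bounded_linear_left int]
      set_integral_bounded_linear(2)[OF matmul.bounded_linear_right int]
    by (simp add: mat_Gamma_eq g_def[abs_def])
qed

section \<open>Eigenmatrices and invertibility of the Gamma matrix\<close>

lemma set_integral_Gamma_complex:
  assumes "Re c > 0"
  shows "set_integrable lborel {0<..} (\<lambda>s. exp (- s) *\<^sub>R (of_real s powr (c - 1)))"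
    "(LINT s:{0<..}|lborel. exp (- s) *\<^sub>R (of_real s powr (c - 1))) = Gamma c"
proof -
  have eq: "(\<lambda>s. exp (- s) *\<^sub>R (of_real s powr (c - 1))) = (\<lambda>s. complex_of_real s powr (c - 1) / of_real (exp s))"
    by (auto simp: fun_eq_iff scaleR_conv_of_real exp_minus field_simps)
  have cont: "continuous_on {0<..} (\<lambda>s. complex_of_real s powr (c - 1) / of_real (exp s))"
    by (intro continuous_intros) auto
  have "set_integrable lebesgue {0<..} (\<lambda>s. complex_of_real s powr (c - 1) / of_real (exp s))"
    by (rule absolutely_integrable_Gamma_integral'[OF assms])
  then show "set_integrable lborel {0<..} (\<lambda>s. exp (- s) *\<^sub>R (complex_of_real s powr (c - 1)))"
    \<comment> \<open>The integrand is continuous on the half-line, hence Borel after multiplication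
      by the indicator, so integrability descends from the completed measure to
      \<open>lborel\<close>.\<close>
    unfolding eq set_integrable_def
    using borel_measurable_continuous_on_indicator[OF _ cont] by (subst (asm) integrable_completion) auto
  from set_borel_integral_eq_integral(2)[OF this] Gamma_integral_complex'[OF assms]
  show "(LINT s:{0<..}|lborel. exp (- s) *\<^sub>R (of_real s powr (c - 1))) = Gamma c"
    unfolding eq by (simp add: integral_unique)
qed

text \<open>On \<open>B\<close> the power with exponent \<open>M - mat 1\<close> acts as the scalar
  power with exponent \<open>c - 1\<close>, which leaves the scalar Gamma integral.\<close>

lemma mat_Gamma_eigen:
  assumes "positive_stable M" "M ** B = c *\<^sub>C B" "Re c > 0"
  shows "mat_Gamma M ** B = Gamma c *\<^sub>C B"
proof -
  define g where "g s = exp (- s) *\<^sub>R mat_powr (of_real s) (M - mat 1)" for s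
  have int: "set_integrable lborel {0<..} g"
    unfolding g_def[abs_def] by (rule set_integrable_Gamma_kernel) (use assms in auto)
  have "mat_Gamma M ** B = (LINT s:{0<..}|lborel. g s ** B)"
    unfolding set_integral_bounded_linear(2)[OF matmul.bounded_linear_left int]
    by (simp add: mat_Gamma_eq g_def[abs_def])
  also have "\<dots> = (LINT s:{0<..}|lborel. (exp (- s) *\<^sub>R (of_real s powr (c - 1))) *\<^sub>C B)"
  proof (rule set_lebesgue_integral_cong)
    show "\<forall>s. s \<in> {0<..} \<longrightarrow> g s ** B = (exp (- s) *\<^sub>R (of_real s powr (c - 1))) *\<^sub>C B"
    proof (intro allI impI)
      fix s :: real assume "s \<in> {0<..}"
      then have s: "s > 0" by simp
      have "(Ln (of_real s) *\<^sub>C (M - mat 1)) ** B = (Ln (of_real s) * (c - 1)) *\<^sub>C B"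
        by (simp add: cscale_matmul_left matmul.diff_left assms(2) mat_matmul cscale.diff_left cscale.diff_right ring_distribs)
      from mat_exp_eigen[OF this]
      show "g s ** B = (exp (- s) *\<^sub>R (of_real s powr (c - 1))) *\<^sub>C B"
        using s by (simp add: g_def mat_powr_def matmul.scaleR_left powr_def mult.commute cscale.scaleR_left)
    qed
  qed auto
  also have "\<dots> = Gamma c *\<^sub>C B"
    unfolding set_integral_bounded_linear(2)[OF cscale.bounded_linear_left set_integral_Gamma_complex(1)[OF assms(3)]]
    by (simp add: set_integral_Gamma_complex(2)[OF assms(3)])
  finally show ?thesis .
qed

text \<open>
  The kernel of \<open>\<Gamma>(M)\<close> is invariant under \<open>M\<close>, so a nonzero kernel would contain an eigenvector of
  \<open>M\<close>, on which \<open>\<Gamma>(M)\<close> acts as the scalar \<open>\<Gamma>(c) \<noteq> 0\<close>.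
\<close>

lemma invertible_mat_Gamma:
  fixes M :: "complex^'n^'n"
  assumes "positive_stable M"
  shows "invertible (mat_Gamma M)"
proof -
  have ker: "B = 0" if ker_B: "mat_Gamma M ** B = 0" for B :: "complex^'n^'n"
  proof (rule ccontr)
    assume "B \<noteq> 0"
    have step: "mat_Gamma M ** ((M - mat c) ** B) = 0" if "mat_Gamma M ** B = 0" for B :: "complex^'n^'n" and c
    proof -
      have "mat_Gamma M ** (M - mat c) = (M - mat c) ** mat_Gamma M"
        by (rule mat_Gamma_commute[OF assms])
           (simp add: matmul.diff_left matmul.diff_right mat_matmul matmul_mat)
      then have "mat_Gamma M ** ((M - mat c) ** B) = (M - mat c) ** (mat_Gamma M ** B)"
        by (simp add: matrix_mul_assoc)
      then show ?thesis
        by (simp add: that matmul.zero_right)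
    qed
    obtain B' c where B': "mat_Gamma M ** B' = 0" "B' \<noteq> 0" "M ** B' = c *\<^sub>C B'"
      by (rule ex_eigenmatrix[where P = "\<lambda>B. mat_Gamma M ** B = 0" and M = M, OF ker_B \<open>B \<noteq> 0\<close>])
         (erule step, rule that)
    have c: "Re c > 0"
      using is_eigenvalueI[OF B'(3,2)] assms by (simp add: positive_stable_def)
    then have "Gamma c *\<^sub>C B' = 0"
      using mat_Gamma_eigen[OF assms B'(3)] B'(1) by simp
    then have "norm (Gamma c) = 0"
      using B'(2) norm_cscale[of "Gamma c" B'] by simp
    \<comment> \<open>\<open>Gamma\<close> takes the value 0 only at its poles, the nonpositive
      integers, where 0 is a default value.\<close>
    with c show False
      by (auto simp: Gamma_eq_zero_iff elim!: nonpos_Ints_cases)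
  qed
  have "v = 0" if "mat_Gamma M *v v = 0" for v
  proof -
    \<comment> \<open>All columns of \<open>B\<close> equal \<open>v\<close>, which turns the
      statement about matrices into one about vectors.\<close>
    define B :: "complex^'n^'n" where "B = (\<chi> i j. v $ i)"
    have "mat_Gamma M ** B = 0"
      using that by (simp add: vec_eq_iff B_def matrix_matrix_mult_def matrix_vector_mult_def)
    then have "B = 0"
      by (rule ker)
    then show ?thesis
      by (simp add: vec_eq_iff B_def)
  qed
  then show ?thesis
    by (simp add: invertible_left_inverse matrix_left_invertible_ker)
qed

text \<open>\<open>matrix_inv\<close> is a choice of a two-sided inverse, so its properties follow
  from the existence of one.\<close>

lemma matrix_inv_matmul:
  assumes "invertible A"
  shows "A ** matrix_inv A = mat 1" "matrix_inv A ** A = mat 1"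
  using someI_ex[OF assms[unfolded invertible_def]] by (simp_all add: matrix_inv_def)

lemma matrix_inv_commute:
  fixes A B :: "complex^'n^'n"
  assumes "invertible A" "A ** B = B ** A"
  shows "matrix_inv A ** B = B ** matrix_inv A"
proof -
  have "matrix_inv A ** B = matrix_inv A ** (B ** A) ** matrix_inv A"
    by (simp add: matrix_mul_assoc[symmetric] matrix_inv_matmul[OF assms(1)])
  also have "\<dots> = matrix_inv A ** A ** B ** matrix_inv A"
    by (simp add: matrix_mul_assoc flip: assms(2))
  finally show ?thesis
    by (simp add: matrix_inv_matmul[OF assms(1)])
qed

section \<open>Series with inverse Gamma matrices as coefficients\<close>

abbreviation Gamma_inv :: "complex^'n^'n \<Rightarrow> nat \<Rightarrow> complex^'n^'n" where
  "Gamma_inv M m \<equiv> matrix_inv (mat_Gamma (M + mat (of_nat m)))"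

lemma Gamma_inv_commute:
  assumes "positive_stable M" "M ** B = B ** M"
  shows "Gamma_inv M m ** B = B ** Gamma_inv M m"
proof (rule matrix_inv_commute)
  have "(M + mat (of_nat m)) ** B = B ** (M + mat (of_nat m))"
    by (simp add: matmul.add_left matmul.add_right mat_matmul matmul_mat assms)
  then show "mat_Gamma (M + mat (of_nat m)) ** B = B ** mat_Gamma (M + mat (of_nat m))"
    by (intro mat_Gamma_commute positive_stable_add_nat assms)
qed (intro invertible_mat_Gamma positive_stable_add_nat assms)

text \<open>The functional equation of the Gamma function, read for the inverses.\<close>

lemma Gamma_inv_Suc:
  assumes "positive_stable M"
  shows "Gamma_inv M (Suc m) ** (M + mat (of_nat m)) = Gamma_inv M m"
proof -
  let ?M = "M + mat (of_nat m)"
  have M: "M + mat (of_nat (Suc m)) = ?M + mat 1"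
    by (simp add: mat_add[symmetric] add.assoc add.commute)
  have ps: "positive_stable ?M"
    by (rule positive_stable_add_nat[OF assms])
  have inv: "invertible (mat_Gamma ?M)" "invertible (mat_Gamma (?M + mat 1))"
    using invertible_mat_Gamma positive_stable_add_nat[OF assms, of m]
      positive_stable_add_nat[OF assms, of "Suc m"] unfolding M by auto
  have "matrix_inv (mat_Gamma (?M + mat 1)) ** ?M
      = matrix_inv (mat_Gamma (?M + mat 1)) ** (?M ** mat_Gamma ?M) ** matrix_inv (mat_Gamma ?M)"
    by (simp add: matrix_mul_assoc[symmetric] matrix_inv_matmul[OF inv(1)])
  also have "\<dots> = matrix_inv (mat_Gamma ?M)"
    using matrix_inv_matmul[OF inv(2)] by (simp add: mat_Gamma_plus_1[OF ps])
  finally show ?thesis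
    unfolding M .
qed

text \<open>In the recursion with factor \<open>M + mat (of_nat m)\<close> the scalar part grows
  while \<open>M\<close> stays fixed, so eventually each inverse is smaller than its predecessor by
  a factor of order m.\<close>

lemma norm_Gamma_inv_Suc:
  fixes M :: "complex^'n^'n"
  assumes "positive_stable M"
  obtains \<kappa> where "\<kappa> \<ge> 0" "\<And>m. (real m - \<kappa>) * norm (Gamma_inv M (Suc m)) \<le> norm (Gamma_inv M m)"
proof -
  obtain K where K: "K \<ge> 0" "\<And>(X :: complex^'n^'n) (Y :: complex^'n^'n). norm (X ** Y) \<le> norm X * norm Y * K"
    using matmul.nonneg_bounded by blast
  show thesis
  proof (rule that[of "norm M * K"])
    fix m
    let ?G = "Gamma_inv M (Suc m)"
    have "of_nat m *\<^sub>C ?G = Gamma_inv M m - ?G ** M"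
      using Gamma_inv_Suc[OF assms, of m] by (simp add: matmul.add_right matmul_mat algebra_simps)
    then have "real m * norm ?G = norm (Gamma_inv M m - ?G ** M)"
      using norm_cscale[of "of_nat m" ?G] by simp
    also have "\<dots> \<le> norm (Gamma_inv M m) + norm (?G ** M)"
      by (rule norm_triangle_ineq4)
    also have "norm (?G ** M) \<le> norm ?G * norm M * K"
      by (rule K)
    finally show "(real m - norm M * K) * norm ?G \<le> norm (Gamma_inv M m)"
      by (simp add: algebra_simps)
  qed (use K in simp)
qed

text \<open>Ratio test. The weights may grow like a factorial: the inverse Gamma matrices compensate
  for that, and \<open>1 / fact m\<close> still beats the powers of \<open>r\<close>. It is used
  once with powers as weights, for pointwise convergence, and once with Gamma values, for
  integrals.\<close>

lemma summable_Gamma_inv: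
  fixes w :: "nat \<Rightarrow> real"
  assumes "positive_stable M" "r \<ge> 0" "a \<ge> 0"
    and w: "\<And>m. w m \<ge> 0" "\<And>m. w (Suc m) \<le> (a + real m) * w m"
  shows "summable (\<lambda>m. r ^ m / fact m * norm (Gamma_inv M m) * w m)"
proof -
  obtain \<kappa> where \<kappa>: "\<kappa> \<ge> 0" "\<And>m. (real m - \<kappa>) * norm (Gamma_inv M (Suc m)) \<le> norm (Gamma_inv M m)"
    using norm_Gamma_inv_Suc[OF assms(1)] by blast
  \<comment> \<open>Beyond \<open>N\<close> the quotient \<open>r / (m + 1)\<close> is at most 1/8
    and \<open>a + m\<close> is at most \<open>4 * (m - \<kappa>)\<close>; together they give the
    ratio 1/2.\<close>
  obtain N :: nat where N: "real N \<ge> a + 4 * \<kappa> + 8 * r"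
    using real_arch_simple by blast
  show ?thesis
  proof (rule summable_ratio_test[of "1/2" N])
    fix m assume "m \<ge> N"
    then have m: "real m \<ge> a + 4 * \<kappa> + 8 * r"
      using N by linarith
    let ?c = "norm (Gamma_inv M m)" and ?c' = "norm (Gamma_inv M (Suc m))"
    have "r ^ Suc m / fact (Suc m) * ?c' * w (Suc m) = r ^ m / fact m * (r / real (Suc m)) * ?c' * w (Suc m)"
      by (simp add: field_simps)
    also have "\<dots> \<le> r ^ m / fact m * (1 / 8) * ?c' * (4 * (real m - \<kappa>) * w m)"
    proof (intro mult_mono order_refl)
      show "r / real (Suc m) \<le> 1 / 8"
        using m \<kappa>(1) assms(3) by (simp add: field_simps)
      have "w (Suc m) \<le> (a + real m) * w m"
        by (rule w)
      also have "\<dots> \<le> 4 * (real m - \<kappa>) * w m"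
        using m assms(2,3) \<kappa>(1) w(1)[of m] by (intro mult_right_mono) auto
      finally show "w (Suc m) \<le> 4 * (real m - \<kappa>) * w m" .
    qed (use assms w(1) in auto)
    also have "\<dots> = r ^ m / fact m * (1 / 2) * ((real m - \<kappa>) * ?c') * w m"
      by (simp add: field_simps del: of_nat_Suc)
    also have "\<dots> \<le> r ^ m / fact m * (1 / 2) * ?c * w m"
      by (intro mult_right_mono mult_left_mono \<kappa> w) (use assms in auto)
    finally show "norm (r ^ Suc m / fact (Suc m) * ?c' * w (Suc m))
        \<le> 1 / 2 * norm (r ^ m / fact m * ?c * w m)"
      using assms w(1) by (simp add: abs_mult)
  qed simp
qed

section \<open>Termwise integration\<close>

text \<open>Integrating over (0, x) or (x, \<infinity>) turns this into the term of index
  \<open>m\<close> of the series for \<open>incomplete_exp_e\<close> or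
  \<open>incomplete_exp_E\<close>.\<close>

definition Gamma_term :: "complex^'n^'n \<Rightarrow> complex \<Rightarrow> nat \<Rightarrow> real \<Rightarrow> complex^'n^'n" where
  "Gamma_term M t m v = (t ^ m / fact m) *\<^sub>C
     (Gamma_inv M m ** (exp (- v) *\<^sub>R mat_powr (of_real v) (M + mat (of_nat m) - mat 1)))"

text \<open>Isolates the dependence on \<open>m\<close> in a coefficient and the power
  \<open>v ^ m\<close>; the remaining kernel is the same for all terms.\<close>

lemma norm_Gamma_term_le:
  fixes M :: "complex^'n^'n"
  obtains K where "K \<ge> 0"
    "\<And>t m v. v > 0 \<Longrightarrow> norm (Gamma_term M t m v) \<le>
       K * (norm t ^ m / fact m * norm (Gamma_inv M m) * (v ^ m * norm (exp (- v) *\<^sub>R mat_powr (of_real v) (M - mat 1))))"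
proof -
  obtain K where K: "K \<ge> 0" "\<And>(X :: complex^'n^'n) (Y :: complex^'n^'n). norm (X ** Y) \<le> norm X * norm Y * K"
    using matmul.nonneg_bounded by blast
  show thesis
  proof (rule that[OF K(1)])
    fix t m and v :: real assume v: "v > 0"
    let ?P = "exp (- v) *\<^sub>R mat_powr (of_real v) (M + mat (of_nat m) - mat 1)"
    have "norm (Gamma_term M t m v) = norm t ^ m / fact m * norm (Gamma_inv M m ** ?P)"
      by (simp add: Gamma_term_def norm_cscale norm_divide norm_power)
    also have "\<dots> \<le> norm t ^ m / fact m * (norm (Gamma_inv M m) * norm ?P * K)"
      by (intro mult_left_mono K) simp
    also have "norm ?P = v ^ m * norm (exp (- v) *\<^sub>R mat_powr (of_real v) (M - mat 1))"
      using v by (simp add: mat_powr_add_nat_diff_mat_1)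
    finally show "norm (Gamma_term M t m v) \<le>
       K * (norm t ^ m / fact m * norm (Gamma_inv M m) * (v ^ m * norm (exp (- v) *\<^sub>R mat_powr (of_real v) (M - mat 1))))"
      by (simp add: mult_ac)
  qed
qed

lemma summable_norm_Gamma_term:
  assumes "positive_stable M" "v > 0"
  shows "summable (\<lambda>m. norm (Gamma_term M t m v))"
proof -
  obtain K where K: "K \<ge> 0"
    "\<And>t m v. v > 0 \<Longrightarrow> norm (Gamma_term M t m v) \<le>
       K * (norm t ^ m / fact m * norm (Gamma_inv M m) * (v ^ m * norm (exp (- v) *\<^sub>R mat_powr (of_real v) (M - mat 1))))"
    using norm_Gamma_term_le by blast
  have "summable (\<lambda>m. norm t ^ m / fact m * norm (Gamma_inv M m) * (v ^ m * norm (exp (- v) *\<^sub>R mat_powr (of_real v) (M - mat 1))))"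
    \<comment> \<open>The weights grow by the exact factor \<open>v\<close>, which is at most
      \<open>v + real m\<close>.\<close>
    by (rule summable_Gamma_inv[where a = v]) (use assms in \<open>auto intro!: mult_right_mono\<close>)
  then have "summable (\<lambda>m. K * (norm t ^ m / fact m * norm (Gamma_inv M m) * (v ^ m * norm (exp (- v) *\<^sub>R mat_powr (of_real v) (M - mat 1)))))"
    by (rule summable_mult)
  then show ?thesis
    by (rule summable_comparison_test') (use K assms in auto)
qed

text \<open>The integrated norms are bounded through the scalar Gamma function at
  \<open>\<delta> + real m\<close> and \<open>a + real m\<close>; this is what the exchange of sum
  and integral requires.\<close>

lemma summable_integral_norm_Gamma_term:
  assumes "positive_stable M" "S \<subseteq> {0<..}"
  shows "summable (\<lambda>m. LINT v|lborel. norm (indicator S v *\<^sub>R Gamma_term M t m v))"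
proof -
  obtain K where K: "K \<ge> 0"
    "\<And>t m v. v > 0 \<Longrightarrow> norm (Gamma_term M t m v) \<le>
       K * (norm t ^ m / fact m * norm (Gamma_inv M m) * (v ^ m * norm (exp (- v) *\<^sub>R mat_powr (of_real v) (M - mat 1))))"
    using norm_Gamma_term_le by blast
  obtain L \<delta> a where L: "L \<ge> 0" "\<delta> > 0" "\<delta> \<le> a"
    "\<And>s. s > 0 \<Longrightarrow> norm (mat_powr (of_real s) M) \<le> L * (s powr \<delta> + s powr a)"
    using positive_stable_mat_powr_bound[OF assms(1)] by blast
  \<comment> \<open>Each summand satisfies the scalar functional equation, and
    \<open>\<delta> \<le> a\<close> makes \<open>a + real m\<close> a common bound for the two
    factors.\<close>
  define w where "w m = Gamma (\<delta> + real m) + Gamma (a + real m)" for m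
  define C where "C m = K * L * (norm t ^ m / fact m * norm (Gamma_inv M m))" for m
  have C: "C m \<ge> 0" for m
    using K L by (simp add: C_def)
  have w0: "w m \<ge> 0" for m
    using L(2,3) Gamma_real_pos[of "\<delta> + real m"] Gamma_real_pos[of "a + real m"] by (simp add: w_def)
  have w_Suc: "w (Suc m) \<le> (a + real m) * w m" for m
  proof -
    have "Gamma (b + real (Suc m)) = (b + real m) * Gamma (b + real m)" if "b > 0" for b :: real
    proof -
      have "b + real m \<notin> \<int>\<^sub>\<le>\<^sub>0"
        using that nonpos_Ints_nonpos[of "b + real m"] by auto
      from Gamma_plus1[OF this] show ?thesis
        by (simp add: add_ac)
    qed
    then have "w (Suc m) = (\<delta> + real m) * Gamma (\<delta> + real m) + (a + real m) * Gamma (a + real m)"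
      using L by (simp add: w_def)
    also have "\<dots> \<le> (a + real m) * w m"
      using L Gamma_real_pos[of "\<delta> + real m"] by (simp add: w_def ring_distribs mult_right_mono)
    finally show ?thesis .
  qed
  have "summable (\<lambda>m. norm t ^ m / fact m * norm (Gamma_inv M m) * w m)"
    by (rule summable_Gamma_inv[OF assms(1) _ _ w0 w_Suc]) (use L in auto)
  then have "summable (\<lambda>m. K * L * (norm t ^ m / fact m * norm (Gamma_inv M m) * w m))"
    by (rule summable_mult)
  then have "summable (\<lambda>m. C m * w m)"
    by (simp add: C_def mult_ac)
  moreover have "norm (LINT v|lborel. norm (indicator S v *\<^sub>R Gamma_term M t m v)) \<le> C m * w m" for m
  proof -
    define g where "g b v = indicator {0<..} v *\<^sub>R (exp (- v) * v powr (b + real m - 1))" for b v :: real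
    have g: "has_bochner_integral lborel (g b) (Gamma (b + real m))" if "b > 0" for b
      using has_bochner_integral_Gamma_real[of "b + real m"] that by (simp add: g_def[abs_def])
    have G: "has_bochner_integral lborel (\<lambda>v. C m * (g \<delta> v + g a v)) (C m * w m)"
      unfolding w_def using L by (intro has_bochner_integral_mult_right has_bochner_integral_add g) auto
    have bound: "norm (indicator S v *\<^sub>R Gamma_term M t m v) \<le> C m * (g \<delta> v + g a v)" for v
    proof (cases "v \<in> S")
      case True
      then have v: "v > 0" using assms(2) by auto
      have "v ^ m * norm (exp (- v) *\<^sub>R mat_powr (of_real v) (M - mat 1))
          = v ^ m * exp (- v) / v * norm (mat_powr (of_real v) M)"
        using v by (simp add: mat_powr_diff_mat_1)
      also have "\<dots> \<le> v ^ m * exp (- v) / v * (L * (v powr \<delta> + v powr a))"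
        using v by (intro mult_left_mono L) auto
      also have "\<dots> = L * (g \<delta> v + g a v)"
        using v by (simp add: g_def powr_add powr_diff powr_realpow field_simps)
      finally have "norm t ^ m / fact m * norm (Gamma_inv M m) * (v ^ m * norm (exp (- v) *\<^sub>R mat_powr (of_real v) (M - mat 1)))
          \<le> norm t ^ m / fact m * norm (Gamma_inv M m) * (L * (g \<delta> v + g a v))"
        by (rule mult_left_mono) auto
      then have "K * (norm t ^ m / fact m * norm (Gamma_inv M m) * (v ^ m * norm (exp (- v) *\<^sub>R mat_powr (of_real v) (M - mat 1))))
          \<le> K * (norm t ^ m / fact m * norm (Gamma_inv M m) * (L * (g \<delta> v + g a v)))"
        by (rule mult_left_mono) (rule K)
      with K(2)[OF v, of t m] True show ?thesis
        by (simp add: C_def mult_ac)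
    next
      case False
      then show ?thesis
        using C by (simp add: g_def)
    qed
    have "(LINT v|lborel. norm (indicator S v *\<^sub>R Gamma_term M t m v)) \<le> (LINT v|lborel. C m * (g \<delta> v + g a v))"
    proof (rule integral_mono')
      show "integrable lborel (\<lambda>v. C m * (g \<delta> v + g a v))"
        using G by (simp add: has_bochner_integral_iff)
      show "0 \<le> C m * (g \<delta> v + g a v)" for v
        using C by (simp add: g_def)
    qed (rule bound)
    also have "\<dots> = C m * w m"
      using G by (simp add: has_bochner_integral_iff)
    finally show ?thesis
      by simp
  qed
  ultimately show ?thesis
    by (rule summable_comparison_test')
qed

text \<open>Sum and integral are exchanged by absolute convergence, and then the constant matrices
  are pulled out of each integral. The indicator of \<open>S\<close> inside the terms makes the
  pointwise series converge for every real argument.\<close>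

lemma
  assumes "positive_stable M" and S: "S \<in> sets borel" "S \<subseteq> {0<..}"
  shows set_integrable_Gamma_series: "set_integrable lborel S (\<lambda>v. \<Sum>m. Gamma_term M t m v)"
    and set_integral_Gamma_series: "(LINT v:S|lborel. \<Sum>m. Gamma_term M t m v) =
      (\<Sum>m. (t ^ m / fact m) *\<^sub>C (Gamma_inv M m **
         (LINT v:S|lborel. exp (- v) *\<^sub>R mat_powr (of_real v) (M + mat (of_nat m) - mat 1))))"
proof -
  define f where "f m v = indicator S v *\<^sub>R Gamma_term M t m v" for m v
  note term_integral = set_integral_bounded_linear[OF
      bounded_linear_compose[OF cscale.bounded_linear_right matmul.bounded_linear_right]
      set_integrable_Gamma_kernel[OF positive_stable_add_nat[OF assms(1)] S]]
  have int: "integrable lborel (f m)" for m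
    using term_integral(1)
    by (simp add: f_def[abs_def] Gamma_term_def set_integrable_def)
  have sm: "summable (\<lambda>m. norm (f m v))" for v
    using summable_norm_Gamma_term[OF assms(1), of v t] S(2)
    by (cases "v \<in> S") (auto simp: f_def)
  have sm2: "summable (\<lambda>m. LINT v|lborel. norm (f m v))"
    unfolding f_def by (rule summable_integral_norm_Gamma_term[OF assms(1) S(2)])
  have f_sum: "(\<Sum>m. f m v) = indicator S v *\<^sub>R (\<Sum>m. Gamma_term M t m v)" for v
    by (cases "v \<in> S") (auto simp: f_def)
  show "set_integrable lborel S (\<lambda>v. \<Sum>m. Gamma_term M t m v)"
    using integrable_suminf[OF int always_eventually[OF allI[OF sm]] sm2]
    by (simp add: set_integrable_def f_sum)
  have "(LINT v:S|lborel. \<Sum>m. Gamma_term M t m v) = (\<Sum>m. LINT v|lborel. f m v)"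
    using integral_suminf[OF int always_eventually[OF allI[OF sm]] sm2]
    by (simp add: set_lebesgue_integral_def f_sum)
  also have "(\<lambda>m. LINT v|lborel. f m v) = (\<lambda>m. LINT v:S|lborel. Gamma_term M t m v)"
    by (simp add: set_lebesgue_integral_def f_def)
  finally show "(LINT v:S|lborel. \<Sum>m. Gamma_term M t m v) =
      (\<Sum>m. (t ^ m / fact m) *\<^sub>C (Gamma_inv M m **
         (LINT v:S|lborel. exp (- v) *\<^sub>R mat_powr (of_real v) (M + mat (of_nat m) - mat 1))))"
    by (simp only: Gamma_term_def term_integral(2))
qed

section \<open>Bessel matrix functions\<close>

text \<open>All powers are exponentials of multiples of \<open>A\<close> and commute with the
  inverse Gamma matrices, so the series agree term by term. The factor with \<open>l / 2\<close> is
  the power of t with exponent A/2, kept in front for later cancellation.\<close>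

lemma bessel_J_eq_Gamma_series:
  fixes A :: "complex^'n^'n"
  assumes ps: "positive_stable (A + mat 1)" and "v > 0" and l: "- pi < Im (l / 2)" "Im (l / 2) \<le> pi"
  shows "exp (- v) *\<^sub>R (mat_powr (of_real v) ((1 / 2) *\<^sub>C A)
           ** bessel_J A (2 * (of_real (sqrt v) * exp (l / 2))))
         = mat_exp ((l / 2) *\<^sub>C A) ** (\<Sum>m. Gamma_term (A + mat 1) (- exp l) m v)"
proof -
  define E where "E c = mat_exp (c *\<^sub>C A)" for c
  define z where "z = complex_of_real (sqrt v) * exp (l / 2)"
  define y where "y = complex_of_real (ln v)"
  have E_mult: "E c ** E d = E (c + d)" for c d
    by (simp add: E_def mat_exp_cscale_add)
  have E_A: "(A + mat 1) ** E c = E c ** (A + mat 1)" for c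
    unfolding E_def by (rule mat_exp_commute[symmetric])
      (simp add: cscale_matmul_left cscale_matmul_right matmul.add_left matmul.add_right mat_matmul matmul_mat cscale.add_right)
  have E_G: "Gamma_inv (A + mat 1) m ** E c = E c ** Gamma_inv (A + mat 1) m" for m c
    by (rule Gamma_inv_commute[OF ps E_A])
  have v_powr: "mat_powr (of_real v) (c *\<^sub>C A) = E (y * c)" for c
    using \<open>v > 0\<close> by (simp add: mat_powr_def E_def y_def Ln_of_real)
  have "z = exp ((y + l) / 2)"
  proof -
    have "complex_of_real (sqrt v) = exp (y / 2)"
      using \<open>v > 0\<close> by (simp add: y_def powr_half_sqrt[symmetric] powr_def flip: exp_of_real)
    then show ?thesis
      by (simp add: z_def add_divide_distrib exp_add)
  qed
  \<comment> \<open>As \<open>y\<close> is real, the bounds on \<open>l\<close> place this exponent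
    in the strip of the principal logarithm.\<close>
  then have Ln_z: "Ln z = (y + l) / 2"
    using l by (simp add: y_def)
  have z_powr: "mat_powr z (A + mat (of_nat (2 * m))) = (of_real v ^ m * exp l ^ m) *\<^sub>C E ((y + l) / 2)" for m
  proof -
    have "(y + l) / 2 * of_nat (2 * m) = of_nat m * (y + l)"
      by simp
    then have "Ln z *\<^sub>C (A + mat (of_nat (2 * m))) = mat (of_nat m * (y + l)) + ((y + l) / 2) *\<^sub>C A"
      by (simp only: Ln_z cscale.add_right cscale_mat add.commute)
    also have "mat_exp \<dots> = exp (of_nat m * (y + l)) *\<^sub>C E ((y + l) / 2)"
      unfolding E_def
      by (subst mat_exp_add_commuting) (simp_all add: mat_matmul matmul_mat mat_exp_mat cscale_matmul_left)
    also have "exp (of_nat m * (y + l)) = (exp y * exp l) ^ m"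
      by (simp add: exp_of_nat_mult exp_add)
    also have "exp y = of_real v"
      using \<open>v > 0\<close> by (simp add: y_def exp_of_real)
    finally show ?thesis
      by (simp add: mat_powr_def power_mult_distrib)
  qed
  define T where "T m = Gamma_term (A + mat 1) (- exp l) m v" for m
  \<comment> \<open>\<open>U\<close> removes \<open>exp (- v)\<close> and trades half of the
    exponent \<open>A\<close> of v for the exponent A/2 of t.\<close>
  define U where "U = exp v *\<^sub>R E ((l - y) / 2)"
  have T: "T m = ((- exp l) ^ m / fact m * of_real (exp (- v)) * of_real v ^ m) *\<^sub>C (Gamma_inv (A + mat 1) m ** E y)" for m
    unfolding T_def Gamma_term_def mat_powr_add_nat_diff_mat_1[OF \<open>v > 0\<close>]
    using v_powr[of 1]
    by (simp add: matmul.scaleR_right cscale_matmul_right mult_ac flip: cscale_of_real)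
  have J_term: "((- 1) ^ m / fact m) *\<^sub>C (matrix_inv (mat_Gamma (A + mat (of_nat (m + 1)))) **
       mat_powr (2 * z / 2) (A + mat (of_nat (2 * m)))) = U ** T m" for m
  proof -
    have A: "A + mat (of_nat (m + 1)) = A + mat 1 + mat (of_nat m)"
      by (simp add: mat_add[symmetric] add.assoc)
    have "U ** T m = ((- exp l) ^ m / fact m * of_real (exp (- v)) * of_real v ^ m * of_real (exp v)) *\<^sub>C
        (E ((l - y) / 2) ** Gamma_inv (A + mat 1) m ** E y)"
      by (simp add: T U_def cscale_matmul_right cscale_matmul_left matrix_mul_assoc mult_ac flip: cscale_of_real)
    also have "E ((l - y) / 2) ** Gamma_inv (A + mat 1) m ** E y = Gamma_inv (A + mat 1) m ** E ((y + l) / 2)"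
    proof -
      have "(l - y) / 2 + y = (y + l) / 2"
        by (simp add: field_simps)
      then show ?thesis
        by (simp only: E_G[symmetric], simp only: matrix_mul_assoc[symmetric] E_mult)
    qed
    also have "(- exp l) ^ m / fact m * of_real (exp (- v)) * of_real v ^ m * of_real (exp v)
        = (- 1) ^ m / fact m * (of_real v ^ m * exp l ^ m)"
      by (simp add: power_minus[of "exp l"] exp_minus field_simps)
    finally have "U ** T m = ((- 1) ^ m / fact m * (of_real v ^ m * exp l ^ m)) *\<^sub>C
        (Gamma_inv (A + mat 1) m ** E ((y + l) / 2))" .
    moreover have "2 * z / 2 = z"
      by simp
    ultimately show ?thesis
      by (simp only: A z_powr cscale_matmul_right cscale_cscale)
  qed
  have "summable T"
    unfolding T_def by (rule summable_norm_cancel[OF summable_norm_Gamma_term[OF ps \<open>v > 0\<close>]])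
  then have "(\<Sum>m. U ** T m) = U ** (\<Sum>m. T m)"
    by (rule bounded_linear.suminf[OF matmul.bounded_linear_right, symmetric])
  then have "bessel_J A (2 * z) = U ** (\<Sum>m. T m)"
    unfolding bessel_J_def J_term .
  moreover have "E (y * (1 / 2)) ** U = exp v *\<^sub>R E (l / 2)"
    by (simp add: U_def matmul.scaleR_right E_mult field_simps)
  ultimately show ?thesis
    by (simp add: v_powr z_def[symmetric] T_def[symmetric] E_def[symmetric] matrix_mul_assoc
        matmul.scaleR_left exp_minus)
qed

text \<open>The rotation in the definition changes the sign of \<open>exp l\<close>, and its matrix
  prefactor cancels the extra exponential of \<open>A\<close> that the rotation produces. The upper
  bound is strict because \<open>bessel_I\<close> is left undefined at argument \<pi>.\<close>

lemma bessel_I_eq_Gamma_series: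
  fixes A :: "complex^'n^'n"
  assumes ps: "positive_stable (A + mat 1)" and "v > 0" and l: "- pi < Im (l / 2)" "Im (l / 2) < pi"
  shows "exp (- v) *\<^sub>R (mat_powr (of_real v) ((1 / 2) *\<^sub>C A)
           ** bessel_I A (2 * (of_real (sqrt v) * exp (l / 2))))
         = mat_exp ((l / 2) *\<^sub>C A) ** (\<Sum>m. Gamma_term (A + mat 1) (exp l) m v)"
proof -
  define z where "z = 2 * (complex_of_real (sqrt v) * exp (l / 2))"
  have "z = exp (complex_of_real (ln (2 * sqrt v)) + l / 2)"
    using \<open>v > 0\<close> by (simp add: z_def exp_add exp_of_real)
  moreover from this have "Ln z = complex_of_real (ln (2 * sqrt v)) + l / 2"
    using l by simp
  ultimately have Arg: "Arg z = Im (l / 2)"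
    by (simp add: Arg_eq_Im_Ln)
  text \<open>Rotating \<open>z\<close> by \<open>\<plusminus>\<pi>/2\<close> moves \<open>l\<close> by \<open>\<plusminus>i\<pi>\<close>.\<close>
  have rotated: "exp (- v) *\<^sub>R (mat_powr (of_real v) ((1 / 2) *\<^sub>C A) **
      (mat_exp ((- (k / 2)) *\<^sub>C A) ** bessel_J A (z * exp (k / 2))))
      = mat_exp ((l / 2) *\<^sub>C A) ** (\<Sum>m. Gamma_term (A + mat 1) (exp l) m v)"
    if "exp k = - 1" "- pi < Im ((l + k) / 2)" "Im ((l + k) / 2) \<le> pi" for k
  proof -
    let ?X = "mat_powr (of_real v) ((1 / 2) *\<^sub>C A)" and ?P = "mat_exp ((- (k / 2)) *\<^sub>C A)"
    let ?J = "bessel_J A (2 * (of_real (sqrt v) * exp ((l + k) / 2)))"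
    have z_rot: "z * exp (k / 2) = 2 * (of_real (sqrt v) * exp ((l + k) / 2))"
      by (simp add: z_def add_divide_distrib exp_add)
    have "?X ** ?P = ?P ** ?X"
      by (intro mat_powr_commute mat_exp_commute[symmetric]) (simp add: cscale_matmul_left cscale_matmul_right)
    then have "exp (- v) *\<^sub>R (?X ** (?P ** ?J)) = ?P ** (exp (- v) *\<^sub>R (?X ** ?J))"
      by (simp add: matrix_mul_assoc matmul.scaleR_right)
    also note bessel_J_eq_Gamma_series[OF ps \<open>v > 0\<close> that(2,3)]
    also have "?P ** (mat_exp (((l + k) / 2) *\<^sub>C A) ** X) = mat_exp ((l / 2) *\<^sub>C A) ** X" for X :: "complex^'n^'n"
      by (simp add: matrix_mul_assoc add_divide_distrib flip: mat_exp_cscale_add)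
    also have "- exp (l + k) = exp l"
      by (simp add: exp_add that(1))
    finally show ?thesis
      by (simp only: z_rot)
  qed
  show ?thesis
  \<comment> \<open>Below \<pi>/2 the rotation goes up, otherwise down; either way the rotated
    argument stays in the principal range.\<close>
  proof (cases "Im (l / 2) < pi / 2")
    case True
    then have "bessel_I A z = mat_exp ((- (\<i> * pi / 2)) *\<^sub>C A) ** bessel_J A (z * exp (\<i> * pi / 2))"
      using Arg l by (simp add: bessel_I_def)
    then show ?thesis
      using rotated[of "\<i> * pi"] True l by (simp add: z_def[symmetric])
  next
    case False
    then have "bessel_I A z = mat_exp ((\<i> * pi / 2) *\<^sub>C A) ** bessel_J A (z * exp (- (\<i> * pi / 2)))"
      using Arg l by (simp add: bessel_I_def)
    then show ?thesis
      using rotated[of "- (\<i> * pi)"] False l by (simp add: z_def[symmetric] exp_minus)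
  qed
qed

section \<open>The integral representations\<close>

text \<open>The power of exponent -A/2 cancels the factor in front of the series, and termwise
  integration does the rest. The series parameter \<open>t\<close> is separate from
  \<open>l\<close>, so that \<open>exp l\<close> and \<open>- exp l\<close> can both be
  inserted.\<close>

lemma incomplete_exp_integral_representation:
  fixes A :: "complex^'n^'n"
  assumes ps: "positive_stable (A + mat 1)" and "x > 0"
    and f: "\<And>v. v > 0 \<Longrightarrow> f v = mat_exp ((l / 2) *\<^sub>C A) ** (\<Sum>m. Gamma_term (A + mat 1) t m v)"
  shows "interval_lebesgue_integrable lborel 0 (ereal x) f \<and>
    incomplete_exp_e x t (A + mat 1) = mat_exp (l *\<^sub>C (- 1 / 2) *\<^sub>C A) ** (LBINT v=0..ereal x. f v) \<and>
    interval_lebesgue_integrable lborel (ereal x) \<infinity> f \<and>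
    incomplete_exp_E x t (A + mat 1) = mat_exp (l *\<^sub>C (- 1 / 2) *\<^sub>C A) ** (LBINT v=ereal x..\<infinity>. f v)"
proof -
  let ?E = "mat_exp ((l / 2) *\<^sub>C A)" and ?E' = "mat_exp (l *\<^sub>C (- 1 / 2) *\<^sub>C A)"
  let ?k = "\<lambda>m v. exp (- v) *\<^sub>R mat_powr (of_real v) (A + mat 1 + mat (of_nat m) - mat 1)"
  have E: "?E' ** (?E ** X) = X" for X :: "complex^'n^'n"
    using mat_exp_cscale_add[of "l * (- 1 / 2)" "l / 2" A, symmetric]
    by (simp add: matrix_mul_assoc cscale.zero_left)
  \<comment> \<open>One statement for a general \<open>S\<close> yields the lower and the upper
    integral.\<close>
  have main: "set_integrable lborel S f \<and> ?E' ** (LINT v:S|lborel. f v) =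
      (\<Sum>m. (t ^ m / fact m) *\<^sub>C (Gamma_inv (A + mat 1) m ** (LINT v:S|lborel. ?k m v)))"
    if S: "S \<in> sets borel" "S \<subseteq> {0<..}" for S
  proof -
    let ?g = "\<lambda>v. ?E ** (\<Sum>m. Gamma_term (A + mat 1) t m v)"
    note g = set_integral_bounded_linear[OF matmul.bounded_linear_right set_integrable_Gamma_series[OF ps S]]
    have eq: "f v = ?g v" if "v \<in> S" for v
      using that S f by auto
    have "set_integrable lborel S f = set_integrable lborel S ?g"
      by (rule set_integrable_cong) (use eq in auto)
    moreover have "(LINT v:S|lborel. f v) = (LINT v:S|lborel. ?g v)"
      by (rule set_lebesgue_integral_cong) (use eq S in auto)
    ultimately show ?thesis
      using g(1)[of ?E t] by (simp only: g(2) E set_integral_Gamma_series[OF ps S] simp_thms)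
  qed
  have sets: "einterval 0 (ereal x) = {0<..<x}" "einterval (ereal x) \<infinity> = {x<..}"
    by (auto simp: einterval_def)
  have "{0<..<x} \<subseteq> {0<..}" "{x<..} \<subseteq> {0<..}"
    using \<open>x > 0\<close> by auto
  then show ?thesis
    using main[of "{0<..<x}"] main[of "{x<..}"] \<open>x > 0\<close>
    by (simp add: interval_lebesgue_integrable_def interval_lebesgue_integral_def sets
        incomplete_exp_e_def incomplete_exp_E_def mat_lower_gamma_def mat_upper_gamma_def)
qed

theorem corollary3p1:
  fixes A :: "complex^'n^'n" and x :: real and t l :: complex
  assumes "positive_stable (A + mat 1)"
    and "\<And>n::nat. invertible (A + mat (of_nat n))"
    and "x > 0"
    \<comment> \<open>\<open>l\<close> is the chosen determination of \<open>log t\<close>, so \<open>\<surd>t = exp (l/2)\<close>; the bounds say that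
        \<open>l/2\<close> is the principal logarithm of \<open>\<surd>t\<close>, as used in \<open>J\<close> and \<open>I\<close> at \<open>2 \<surd>(v t)\<close>\<close>
    and "exp l = t" and "- pi < Im (l / 2)" and "Im (l / 2) \<le> pi"
  shows
    "(Im (l / 2) < pi \<longrightarrow>
        interval_lebesgue_integrable lborel 0 (ereal x)
          (\<lambda>v. exp (- v) *\<^sub>R (mat_powr (of_real v) ((1 / 2) *\<^sub>C A)
                 ** bessel_I A (2 * (of_real (sqrt v) * exp (l / 2))))) \<and>
        incomplete_exp_e x t (A + mat 1) =
          mat_exp (l *\<^sub>C (- 1 / 2) *\<^sub>C A) **
          (LBINT v=0..ereal x. exp (- v) *\<^sub>R (mat_powr (of_real v) ((1 / 2) *\<^sub>C A)
                 ** bessel_I A (2 * (of_real (sqrt v) * exp (l / 2))))) \<and>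
        interval_lebesgue_integrable lborel (ereal x) \<infinity>
          (\<lambda>v. exp (- v) *\<^sub>R (mat_powr (of_real v) ((1 / 2) *\<^sub>C A)
                 ** bessel_I A (2 * (of_real (sqrt v) * exp (l / 2))))) \<and>
        incomplete_exp_E x t (A + mat 1) =
          mat_exp (l *\<^sub>C (- 1 / 2) *\<^sub>C A) **
          (LBINT v=ereal x..\<infinity>. exp (- v) *\<^sub>R (mat_powr (of_real v) ((1 / 2) *\<^sub>C A)
                 ** bessel_I A (2 * (of_real (sqrt v) * exp (l / 2)))))) \<and>
     interval_lebesgue_integrable lborel 0 (ereal x)
       (\<lambda>v. exp (- v) *\<^sub>R (mat_powr (of_real v) ((1 / 2) *\<^sub>C A)
              ** bessel_J A (2 * (of_real (sqrt v) * exp (l / 2))))) \<and>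
     incomplete_exp_e x (- t) (A + mat 1) =
       mat_exp (l *\<^sub>C (- 1 / 2) *\<^sub>C A) **
       (LBINT v=0..ereal x. exp (- v) *\<^sub>R (mat_powr (of_real v) ((1 / 2) *\<^sub>C A)
              ** bessel_J A (2 * (of_real (sqrt v) * exp (l / 2))))) \<and>
     interval_lebesgue_integrable lborel (ereal x) \<infinity>
       (\<lambda>v. exp (- v) *\<^sub>R (mat_powr (of_real v) ((1 / 2) *\<^sub>C A)
              ** bessel_J A (2 * (of_real (sqrt v) * exp (l / 2))))) \<and>
     incomplete_exp_E x (- t) (A + mat 1) =
       mat_exp (l *\<^sub>C (- 1 / 2) *\<^sub>C A) **
       (LBINT v=ereal x..\<infinity>. exp (- v) *\<^sub>R (mat_powr (of_real v) ((1 / 2) *\<^sub>C A)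
              ** bessel_J A (2 * (of_real (sqrt v) * exp (l / 2)))))"
proof -
  \<comment> \<open>The Bessel function is a parameter, so that \<open>bessel_J\<close> with
    \<open>- t\<close> and \<open>bessel_I\<close> with \<open>t\<close> are two instances of one
    representation.\<close>
  define f where "f b v = exp (- v) *\<^sub>R (mat_powr (of_real v) ((1 / 2) *\<^sub>C A) ** b A (2 * (of_real (sqrt v) * exp (l / 2))))"
    for b :: "complex^'n^'n \<Rightarrow> complex \<Rightarrow> complex^'n^'n" and v
  note representation = incomplete_exp_integral_representation[OF assms(1,3), of "f _" l]
  have J: "f bessel_J v = mat_exp ((l / 2) *\<^sub>C A) ** (\<Sum>m. Gamma_term (A + mat 1) (- t) m v)" if "v > 0" for v
    unfolding f_def using bessel_J_eq_Gamma_series[OF assms(1) that assms(5,6)] assms(4) by simp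
  have I: "f bessel_I v = mat_exp ((l / 2) *\<^sub>C A) ** (\<Sum>m. Gamma_term (A + mat 1) t m v)"
    if "v > 0" "Im (l / 2) < pi" for v
    unfolding f_def using bessel_I_eq_Gamma_series[OF assms(1) that(1) assms(5) that(2)] assms(4) by simp
  show ?thesis
    using representation[OF J] representation[OF I] unfolding f_def[abs_def] by blast
qed

end
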